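(* Let $\mathbf{Met}_3^{L}$ be the category of tri-pointed metric spaces and Lipschitz maps preserving the distinguished points. Let $(S,\psi)$ be the coalgebra obtained by Cauchy completing the initial algebra $(G,g)$ of $F=M\otimes -$ on tri-pointed sets, and let $(\mathbb{S},\sigma)$ be the Sierpinski gasket with its coalgebra structure. Then neither $(S,\psi)$ nor $(\mathbb{S},\sigma)$ is a final coalgebra for $F$ on $\mathbf{Met}_3^{L}$.
   Context: A tri-pointed set is a set $X$ with three distinguished elements $T,L,R$ (written $T_X,L_X,R_X$). A tri-pointed metric space is a tri-pointed set with a metric $d$ satisfying $d(x,y)\le 1$ for all $x,y$ and such that any two different ones of the distinguished elements are at distance exactly $1$. Let $M=\{a,b,c\}$. For a tri-pointed set $X$, $M\otimes X$ is the quotient of $M\times X$ by the equivalence relation generated by $(b,T)\sim(a,L)$, $(a,R)\sim(c,T)$, $(c,L)\sim(b,R)$; the class of $(m,x)$ is written $m\otimes x$. Its distinguished elements are $T_{M\otimes X}=a\otimes T$, $L_{M\otimes X}=b\otimes L$, $R_{M\otimes X}=c\otimes R$. If $X$ is a tri-pointed metric space, $M\times X$ has the metric $d((m,x),(n,y))=\frac12 d(x,y)$ if $m=n$ and $1$ if $m\ne n$, and $M\otimes X$ has the quotient metric, which is explicitly: $d(m\otimes x,m\otimes y)=\frac12 d(x,y)$; $d(a\otimes x,b\otimes y)=\frac12\min\{d(x,L)+d(T,y),\,d(x,R)+1+d(R,y)\}$; $d(a\otimes x,c\otimes y)=\frac12\min\{d(x,R)+d(T,y),\,d(x,L)+1+d(L,y)\}$;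 $d(b\otimes x,c\otimes y)=\frac12\min\{d(x,R)+d(L,y),\,d(x,T)+1+d(T,y)\}$. This is again a tri-pointed metric space. The functor $F=M\otimes -$ acts on morphisms by $(M\otimes f)(m\otimes x)=m\otimes f(x)$; $M^n\otimes -$ is its $n$-fold iterate, with elements $m_1\otimes\cdots\otimes m_n\otimes x$. An $F$-coalgebra is a pair $(X,e)$ with $e:X\to F(X)$ a morphism of the category; a coalgebra morphism $(X,e)\to(Y,e')$ is a morphism $f:X\to Y$ with $e'\circ f=F(f)\circ e$; a coalgebra is final if every coalgebra has exactly one coalgebra morphism to it. Let $I=\{T,L,R\}$ with the discrete metric, and $!:I\to M\otimes I$ the map $T\mapsto a\otimes T$, $L\mapsto b\otimes L$, $R\mapsto c\otimes R$. $G$ is the colimit of $I\xrightarrow{!}M\otimes I\xrightarrow{M\otimes !}M^2\otimes I\to\cdots$, i.e. the quotient of the disjoint union of the $M^n\otimes I$ identifying each element with its images along the chain; $[\chi]$ is the class of $\chi$. Distinguished points of $G$: $[T],[L],[R]$. All chain maps are isometric embeddings, and the canonical metric of $G$ is $d_G([\chi],[\chi'])=d(\tilde\chi,\tilde\chi')$, where $\tilde\chi,\tilde\chi'$ are images of $\chi,\chi'$ in a common $M^p\otimes I$. The map $g:M\otimes G\to G$, $g(m\otimes[x])=[m\otimes x]$, is an isometric isomorphism and $(G,g)$ is the initial $F$-algebra on tri-pointed sets. $S$ is the Cauchy completion of $G$ (equivalence classes $[x_n]$ of Cauchy sequences $(x_n)$ in $G$), with distinguished points those of $G$; $s:M\otimes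 S\to S$ is the isometric isomorphism $s(m\otimes[x_n])=[g(m\otimes x_n)]$, and $\psi=s^{-1}$. Let $\sigma_a(x,y)=(x/2,y/2)+(1/4,\sqrt3/4)$, $\sigma_b(x,y)=(x/2,y/2)$, $\sigma_c(x,y)=(x/2,y/2)+(1/2,0)$ on $\mathbb{R}^2$. $\mathbb{S}$ is the unique nonempty compact subset of $\mathbb{R}^2$ with $\mathbb{S}=\sigma_a(\mathbb{S})\cup\sigma_b(\mathbb{S})\cup\sigma_c(\mathbb{S})$, with the Euclidean metric and distinguished points $T=(1/2,\sqrt3/2)$, $L=(0,0)$, $R=(1,0)$. The map $\tau:M\otimes\mathbb{S}\to\mathbb{S}$, $\tau(m\otimes x)=\sigma_m(x)$, is a well-defined bijection preserving distinguished elements, and $\sigma=\tau^{-1}$. *)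

theory Defs
  imports "HOL-Analysis.Analysis" "HOL-Library.FSet"
begin

section \<open>Tri-pointed metric spaces\<close>

record 'a tri_space =
  pts :: "'a set"
  mdst :: "'a \<Rightarrow> 'a \<Rightarrow> real"
  ptT :: 'a
  ptL :: 'a
  ptR :: 'a

definition tri_metric :: "'a tri_space \<Rightarrow> bool" where
  "tri_metric X \<longleftrightarrow>
     Metric_space (pts X) (mdst X) \<and>
     ptT X \<in> pts X \<and> ptL X \<in> pts X \<and> ptR X \<in> pts X \<and>
     (\<forall>x\<in>pts X. \<forall>y\<in>pts X. mdst X x y \<le> 1) \<and>
     mdst X (ptT X) (ptL X) = 1 \<and> mdst X (ptT X) (ptR X) = 1 \<and> mdst X (ptL X) (ptR X) = 1"

text \<open>\<^locale>\<open>Metric_space\<close> demands symmetry and nonnegativity of the distance also off the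
  carrier, so distances that are only meaningful on the carrier are set to \<open>0\<close> elsewhere.\<close>

definition dist_on :: "'a set \<Rightarrow> ('a \<Rightarrow> 'a \<Rightarrow> real) \<Rightarrow> 'a \<Rightarrow> 'a \<Rightarrow> real" where
  "dist_on A d = (\<lambda>x y. if x \<in> A \<and> y \<in> A then d x y else 0)"

text \<open>Maps are normalised to be \<open>undefined\<close> off the carrier, so that equality of morphisms is
  equality of HOL functions. The Lipschitz condition is the one of
  \<^const>\<open>Lipschitz_continuous_map\<close>, for the distance functions of the records.\<close>

definition lip_morphism :: "'a tri_space \<Rightarrow> 'b tri_space \<Rightarrow> ('a \<Rightarrow> 'b) \<Rightarrow> bool" where
  "lip_morphism X Y f \<longleftrightarrow>
     f \<in> pts X \<rightarrow>\<^sub>E pts Y \<and>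
     f (ptT X) = ptT Y \<and> f (ptL X) = ptL Y \<and> f (ptR X) = ptR Y \<and>
     (\<exists>K. \<forall>x\<in>pts X. \<forall>y\<in>pts X. mdst Y (f x) (f y) \<le> K * mdst X x y)"

section \<open>The functor \<open>M \<otimes> -\<close>\<close>

datatype idx = Ma | Mb | Mc

definition equiv_gen :: "'a set \<Rightarrow> ('a \<times> 'a) set \<Rightarrow> ('a \<times> 'a) set" where
  "equiv_gen A r = (r \<union> r\<inverse>)\<^sup>* \<inter> A \<times> A"

definition glue :: "'a tri_space \<Rightarrow> ((idx \<times> 'a) \<times> (idx \<times> 'a)) set" where
  "glue X = {((Mb, ptT X), (Ma, ptL X)), ((Ma, ptR X), (Mc, ptT X)), ((Mc, ptL X), (Mb, ptR X))}"

definition tensor_rel :: "'a tri_space \<Rightarrow> ((idx \<times> 'a) \<times> (idx \<times> 'a)) set" where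
  "tensor_rel X = equiv_gen (UNIV \<times> pts X) (glue X)"

definition tens :: "'a tri_space \<Rightarrow> idx \<Rightarrow> 'a \<Rightarrow> (idx \<times> 'a) set" where
  "tens X m x = tensor_rel X `` {(m, x)}"

fun pair_dist :: "'a tri_space \<Rightarrow> idx \<times> 'a \<Rightarrow> idx \<times> 'a \<Rightarrow> real" where
  "pair_dist X (Ma, x) (Mb, y) =
     1/2 * min (mdst X x (ptL X) + mdst X (ptT X) y) (mdst X x (ptR X) + 1 + mdst X (ptR X) y)"
| "pair_dist X (Ma, x) (Mc, y) =
     1/2 * min (mdst X x (ptR X) + mdst X (ptT X) y) (mdst X x (ptL X) + 1 + mdst X (ptL X) y)"
| "pair_dist X (Mb, x) (Mc, y) =
     1/2 * min (mdst X x (ptR X) + mdst X (ptL X) y) (mdst X x (ptT X) + 1 + mdst X (ptT X) y)"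
| "pair_dist X (Mb, x) (Ma, y) =
     1/2 * min (mdst X y (ptL X) + mdst X (ptT X) x) (mdst X y (ptR X) + 1 + mdst X (ptR X) x)"
| "pair_dist X (Mc, x) (Ma, y) =
     1/2 * min (mdst X y (ptR X) + mdst X (ptT X) x) (mdst X y (ptL X) + 1 + mdst X (ptL X) x)"
| "pair_dist X (Mc, x) (Mb, y) =
     1/2 * min (mdst X y (ptR X) + mdst X (ptL X) x) (mdst X y (ptT X) + 1 + mdst X (ptT X) x)"
| "pair_dist X (m, x) (n, y) = 1/2 * mdst X x y"

text \<open>A function on a quotient is given by its common value on representatives, extracted by
  \<^const>\<open>the_elem\<close> (or, if the value is itself an equivalence class, as the union of the equal
  classes arising from the representatives).\<close>

definition tensor :: "'a tri_space \<Rightarrow> (idx \<times> 'a) set tri_space" where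
  "tensor X =
     \<lparr> pts = (UNIV \<times> pts X) // tensor_rel X,
       mdst = dist_on ((UNIV \<times> pts X) // tensor_rel X)
         (\<lambda>U V. the_elem {pair_dist X p q |p q. p \<in> U \<and> q \<in> V}),
       ptT = tens X Ma (ptT X), ptL = tens X Mb (ptL X), ptR = tens X Mc (ptR X) \<rparr>"

definition tensor_map :: "'b tri_space \<Rightarrow> ('a \<Rightarrow> 'b) \<Rightarrow> (idx \<times> 'a) set \<Rightarrow> (idx \<times> 'b) set" where
  "tensor_map Y f U = (\<Union>(m, x)\<in>U. tens Y m (f x))"

subsection \<open>\<open>M \<otimes> X\<close> is a tri-pointed metric space\<close>

lemma tri_metricD:
  assumes "tri_metric X"
  shows "ptT X \<in> pts X" "ptL X \<in> pts X" "ptR X \<in> pts X"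
    "ptT X \<noteq> ptL X" "ptT X \<noteq> ptR X" "ptL X \<noteq> ptR X"
    "mdst X (ptT X) (ptL X) = 1" "mdst X (ptT X) (ptR X) = 1" "mdst X (ptL X) (ptR X) = 1"
    "mdst X (ptL X) (ptT X) = 1" "mdst X (ptR X) (ptT X) = 1" "mdst X (ptR X) (ptL X) = 1"
    "\<And>x. x \<in> pts X \<Longrightarrow> mdst X x x = 0"
proof -
  interpret Metric_space "pts X" "mdst X" using assms by (simp add: tri_metric_def)
  show "ptT X \<in> pts X" "ptL X \<in> pts X" "ptR X \<in> pts X"
    "mdst X (ptT X) (ptL X) = 1" "mdst X (ptT X) (ptR X) = 1" "mdst X (ptL X) (ptR X) = 1"
    "mdst X (ptL X) (ptT X) = 1" "mdst X (ptR X) (ptT X) = 1" "mdst X (ptR X) (ptL X) = 1"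
    "\<And>x. x \<in> pts X \<Longrightarrow> mdst X x x = 0"
    using assms by (simp_all add: tri_metric_def commute)
  then show "ptT X \<noteq> ptL X" "ptT X \<noteq> ptR X" "ptL X \<noteq> ptR X"
    by (metis zero_neq_one)+
qed

lemma tensor_rel_iff:
  assumes "tri_metric X"
  shows "(p, q) \<in> tensor_rel X \<longleftrightarrow>
    p \<in> UNIV \<times> pts X \<and> (p = q \<or> (p, q) \<in> glue X \<or> (q, p) \<in> glue X)"
proof -
  note D = tri_metricD(1-6)[OF assms]
  let ?r = "glue X \<union> (glue X)\<inverse>"
  have "?r O ?r \<subseteq> Id"
    using D(4-6) by (auto simp: glue_def)
  then have comp: "p = q" if "(p, r) \<in> ?r" "(r, q) \<in> ?r" for p q r
    using that by blast
  have "p = q \<or> (p, q) \<in> ?r" if "(p, q) \<in> ?r\<^sup>*" for p q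
    using that by (induction rule: rtrancl_induct) (use comp in blast)+
  moreover have "?r \<subseteq> (UNIV \<times> pts X) \<times> (UNIV \<times> pts X)"
    using D(1-3) by (auto simp: glue_def)
  ultimately show ?thesis
    unfolding tensor_rel_def equiv_gen_def by blast
qed

lemma equiv_tensor_rel: "equiv (UNIV \<times> pts X) (tensor_rel X)"
proof -
  have "sym ((glue X \<union> (glue X)\<inverse>)\<^sup>*)" by (rule sym_rtrancl) (auto simp: sym_def)
  moreover have "trans ((glue X \<union> (glue X)\<inverse>)\<^sup>*)" by (rule trans_rtrancl)
  ultimately show ?thesis
    unfolding tensor_rel_def equiv_gen_def equiv_def refl_on_def sym_def trans_def by blast
qed

lemma pair_dist_commute:
  assumes "tri_metric X"  "p \<in> UNIV \<times> pts X" "q \<in> UNIV \<times> pts X"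
  shows "pair_dist X p q = pair_dist X q p"
proof -
  interpret Metric_space "pts X" "mdst X" using assms by (simp add: tri_metric_def)
  obtain m x n y where "p = (m,x)" "q = (n,y)" by (metis surj_pair)
  then show ?thesis  by (cases m; cases n; simp add: commute)
qed

lemma pair_dist_cong1:
  assumes X: "tri_metric X" and "(p, p') \<in> glue X" "q \<in> UNIV \<times> pts X"
  shows "pair_dist X p q = pair_dist X p' q"
proof -
  interpret Metric_space "pts X" "mdst X" using assms by (simp add: tri_metric_def)
  note D = tri_metricD[OF assms(1)]
  obtain n y where q: "q = (n,y)" "y \<in> pts X" using assms by (metis SigmaE)
  have le: "mdst X y z \<le> 1" if "z \<in> pts X" for z using q X that by (auto simp: tri_metric_def)
  note lee = le[OF D(1)] le[OF D(2)] le[OF D(3)]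
  have c: "mdst X (ptT X) y = mdst X y (ptT X)" "mdst X (ptL X) y = mdst X y (ptL X)" 
     "mdst X (ptR X) y = mdst X y (ptR X)" by (simp_all add: commute)
  have nn: "mdst X y (ptT X) \<ge> 0" "mdst X y (ptL X) \<ge> 0" "mdst X y (ptR X) \<ge> 0" by auto
  show ?thesis using assms(2) D lee c nn unfolding q(1) glue_def
    by (cases n; auto simp: min_def; use nn lee in linarith)
qed

lemma pair_dist_cong:
  assumes X: "tri_metric X" and "(p, p') \<in> tensor_rel X" "(q, q') \<in> tensor_rel X"
  shows "pair_dist X p q = pair_dist X p' q'"
proof -
  have 1: "pair_dist X p q = pair_dist X p' q" if "(p, p') \<in> tensor_rel X" "q \<in> UNIV \<times> pts X" for p p' q
    using that pair_dist_cong1[OF X] tensor_rel_iff[OF X] by metis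
  have in_: "p \<in> UNIV \<times> pts X"  "q \<in> UNIV \<times> pts X" "p' \<in> UNIV \<times> pts X"  "q' \<in> UNIV \<times> pts X"
    using assms unfolding tensor_rel_def equiv_gen_def by auto
  show ?thesis using 1[OF assms(2) in_(2)] 1[OF assms(3) in_(3)] pair_dist_commute[OF X] in_ by metis
qed

lemma tensor_dist:
  assumes X: "tri_metric X" and x: "x \<in> pts X" "y \<in> pts X"
  shows "mdst (tensor X) (tens X m x) (tens X n y) = pair_dist X (m, x) (n, y)"
proof -
  have "((m,x),(m,x)) \<in> tensor_rel X" "((n,y),(n,y)) \<in> tensor_rel X"
    using x by (simp_all add: tensor_rel_iff[OF X])
  then have "{pair_dist X p q |p q. p \<in> tens X m x \<and> q \<in> tens X n y} = {pair_dist X (m, x) (n, y)}"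
    unfolding tens_def by (auto simp del: pair_dist.simps dest: pair_dist_cong[OF X, symmetric])
  moreover have "tens X m x \<in> (UNIV \<times> pts X) // tensor_rel X" "tens X n y \<in> (UNIV \<times> pts X) // tensor_rel X"
    using x by (auto simp: tens_def quotient_def)
  ultimately show ?thesis by (simp add: tensor_def dist_on_def)
qed

lemma pair_dist_triangle:
  assumes X: "tri_metric X" and x: "x \<in> pts X" "y \<in> pts X" "z \<in> pts X"
  shows "pair_dist X (m, x) (k, z) \<le> pair_dist X (m, x) (n, y) + pair_dist X (n, y) (k, z)"
proof -
  interpret Metric_space "pts X" "mdst X" using X by (simp add: tri_metric_def)
  note D = tri_metricD[OF X]
  define d where "d = mdst X"
  have m: "mdst X = d" by (simp add: d_def)
  have sy: "d u v = d v u" for u v by (simp add: d_def commute)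
  have nn: "d u v \<ge> 0" for u v by (simp add: d_def)
  have U: "d u v \<le> 1" if "u \<in> pts X" "v \<in> pts X" for u v
    using X that by (auto simp: tri_metric_def d_def)
  have tri: "d u w \<le> d u v + d v w" if "u \<in> pts X" "v \<in> pts X" "w \<in> pts X" for u v w
    using that triangle by (simp add: d_def)
  have t: "d x z \<le> d x y + d y z" "\<And>P. P \<in> pts X \<Longrightarrow> d x P \<le> d x y + d y P"
    "\<And>P. P \<in> pts X \<Longrightarrow> d z P \<le> d y z + d y P" "\<And>P. P \<in> pts X \<Longrightarrow> d x z \<le> d x P + d z P"
    "\<And>P Q. P \<in> pts X \<Longrightarrow> Q \<in> pts X \<Longrightarrow> d P Q \<le> d y P + d y Q"
    using tri sy x by metis+
  note TT = t(1) t(2)[OF D(1)] t(2)[OF D(2)] t(2)[OF D(3)]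
    t(3)[OF D(1)] t(3)[OF D(2)] t(3)[OF D(3)]
    t(4)[OF D(1)] t(4)[OF D(2)] t(4)[OF D(3)]
    t(5)[OF D(1) D(2)] t(5)[OF D(1) D(3)] t(5)[OF D(2) D(3)]
  note UU = U[OF x(1) x(3)] U[OF x(1) D(1)] U[OF x(1) D(2)] U[OF x(1) D(3)]
    U[OF x(3) D(1)] U[OF x(3) D(2)] U[OF x(3) D(3)]
  note NN = nn[of x "ptT X"] nn[of x "ptL X"] nn[of x "ptR X"]
    nn[of y "ptT X"] nn[of y "ptL X"] nn[of y "ptR X"]
    nn[of z "ptT X"] nn[of z "ptL X"] nn[of z "ptR X"]
  have P: "d (ptT X) (ptL X) = 1" "d (ptT X) (ptR X) = 1" "d (ptL X) (ptR X) = 1"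
    using D by (auto simp: d_def)
  have S: "d (ptT X) u = d u (ptT X)" "d (ptL X) u = d u (ptL X)" "d (ptR X) u = d u (ptR X)"
    "d z y = d y z" "d z x = d x z" "d y x = d x y" for u
    using sy by auto
  have min: "1/2 * min p q \<le> 1/2 * r \<longleftrightarrow> p \<le> r \<or> q \<le> r" 
    "min p q + r = min (p + r) (q + r)" "r + min p q = min (r + p) (r + q)"
    "1/2 * p + 1/2 * r = 1/2 * (p + r)" "1/2 * p \<le> 1/2 * r \<longleftrightarrow> p \<le> r" 
    for p q r :: real by auto
  show ?thesis
    by (cases m; cases n; cases k;
        simp only: pair_dist.simps m S(1-3)[of x] S(1-3)[of y] S(1-3)[of z] S(4-) min min_le_iff_disj min.bounded_iff;
        (intro conjI)?; rule ccontr; simp only: de_Morgan_disj not_le; (elim conjE)?; use TT[unfolded P] UU NN in linarith)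
qed

lemma tens_eq_iff:
  assumes X: "tri_metric X" and x: "x \<in> pts X" "y \<in> pts X"
  shows "tens X m x = tens X n y \<longleftrightarrow> ((m, x), (n, y)) \<in> tensor_rel X"
  unfolding tens_def by (rule eq_equiv_class_iff[OF equiv_tensor_rel]) (simp_all add: x)

lemma pair_dist_zero:
  assumes X: "tri_metric X" and x: "x \<in> pts X" "y \<in> pts X"
  shows "pair_dist X (m, x) (n, y) = 0 \<longleftrightarrow> ((m, x), (n, y)) \<in> tensor_rel X"
proof -
  interpret Metric_space "pts X" "mdst X" using X by (simp add: tri_metric_def)
  note D = tri_metricD[OF X]
  have *: "min (mdst X u P + mdst X Q v) (mdst X u R + 1 + mdst X S v) = 0 \<longleftrightarrow> u = P \<and> v = Q"
    if "P \<in> pts X" "Q \<in> pts X" "R \<in> pts X" "S \<in> pts X" "u \<in> pts X" "v \<in> pts X" for P Q R S u v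
  proof -
    have nn: "mdst X u P \<ge> 0" "mdst X Q v \<ge> 0" "mdst X u R \<ge> 0" "mdst X S v \<ge> 0" by auto
    have "min (mdst X u P + mdst X Q v) (mdst X u R + 1 + mdst X S v) = 0 \<longleftrightarrow>
        mdst X u P = 0 \<and> mdst X Q v = 0"
      using nn by linarith
    then show ?thesis using zero that by metis
  qed
  show ?thesis
    using x D(1-6) zero[OF x] *
    by (cases m; cases n) (auto simp: tensor_rel_iff[OF X] glue_def)
qed

lemma pair_dist_bounds:
  assumes X: "tri_metric X" and x: "x \<in> pts X" "y \<in> pts X"
  shows "0 \<le> pair_dist X (m, x) (n, y)" "pair_dist X (m, x) (n, y) \<le> 1"
proof -
  interpret Metric_space "pts X" "mdst X" using X by (simp add: tri_metric_def)
  note D = tri_metricD[OF X]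
  have le: "mdst X u v \<le> 1" if "u \<in> pts X" "v \<in> pts X" for u v
    using X that by (auto simp: tri_metric_def)
  have *: "min (mdst X u P + mdst X Q v) r \<le> 2"
    if "P \<in> pts X" "Q \<in> pts X" "u \<in> pts X" "v \<in> pts X" for P Q u v r
    using le[of u P] le[of Q v] that by linarith
  have nn: "mdst X u v \<ge> 0" for u v by simp
  show "0 \<le> pair_dist X (m, x) (n, y)"
    by (cases m; cases n) (simp_all add: nn add_nonneg_nonneg)
  show "pair_dist X (m, x) (n, y) \<le> 1"
    using * D(1-3) x le[OF x] by (cases m; cases n) auto
qed

lemma tri_metric_tensor:
  assumes X: "tri_metric X"
  shows "tri_metric (tensor X)"
proof -
  note D = tri_metricD[OF X]
  have pts: "pts (tensor X) = {tens X m x |m x. x \<in> pts X}"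
    by (auto simp: tensor_def quotient_def tens_def)
  have pts': "ptT (tensor X) = tens X Ma (ptT X)" "ptL (tensor X) = tens X Mb (ptL X)"
    "ptR (tensor X) = tens X Mc (ptR X)" by (simp_all add: tensor_def)
  have d: "mdst (tensor X) (tens X m x) (tens X n y) = pair_dist X (m, x) (n, y)"
    if "x \<in> pts X" "y \<in> pts X" for m n x y using tensor_dist[OF X] that .
  have off: "mdst (tensor X) U V = 0" if "U \<notin> pts (tensor X) \<or> V \<notin> pts (tensor X)" for U V
    using that by (auto simp: tensor_def dist_on_def)
  have "Metric_space (pts (tensor X)) (mdst (tensor X))"
  proof
    fix U V
    show "0 \<le> mdst (tensor X) U V"
      using off[of U V] d pair_dist_bounds(1)[OF X] unfolding pts by fastforce
    show "mdst (tensor X) U V = mdst (tensor X) V U"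
    proof (cases "U \<in> pts (tensor X) \<and> V \<in> pts (tensor X)")
      case True
      then show ?thesis using d pair_dist_commute[OF X] unfolding pts by fastforce
    next
      case False
      then show ?thesis using off by metis
    qed
  next
    fix U V assume "U \<in> pts (tensor X)" "V \<in> pts (tensor X)"
    then show "mdst (tensor X) U V = 0 \<longleftrightarrow> U = V"
      using d pair_dist_zero[OF X] tens_eq_iff[OF X] unfolding pts by force
  next
    fix U V W assume "U \<in> pts (tensor X)" "V \<in> pts (tensor X)" "W \<in> pts (tensor X)"
    then show "mdst (tensor X) U W \<le> mdst (tensor X) U V + mdst (tensor X) V W"
      using d pair_dist_triangle[OF X] unfolding pts by force
  qed
  moreover have "mdst (tensor X) U V \<le> 1" if "U \<in> pts (tensor X)" "V \<in> pts (tensor X)" for U V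
    using that d pair_dist_bounds(2)[OF X] unfolding pts by fastforce
  moreover have "mdst (tensor X) (ptT (tensor X)) (ptL (tensor X)) = 1"
    "mdst (tensor X) (ptT (tensor X)) (ptR (tensor X)) = 1"
    "mdst (tensor X) (ptL (tensor X)) (ptR (tensor X)) = 1"
    unfolding pts' by (simp_all add: d D)
  moreover have "ptT (tensor X) \<in> pts (tensor X)" "ptL (tensor X) \<in> pts (tensor X)"
    "ptR (tensor X) \<in> pts (tensor X)"
    unfolding pts pts' using D by blast+
  ultimately show ?thesis unfolding tri_metric_def by blast
qed

section \<open>Coalgebras\<close>

definition coalgebra :: "'a tri_space \<Rightarrow> ('a \<Rightarrow> (idx \<times> 'a) set) \<Rightarrow> bool" where
  "coalgebra X e \<longleftrightarrow> tri_metric X \<and> lip_morphism X (tensor X) e"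

definition coalgebra_morphism ::
    "'a tri_space \<Rightarrow> ('a \<Rightarrow> (idx \<times> 'a) set) \<Rightarrow> 'b tri_space \<Rightarrow> ('b \<Rightarrow> (idx \<times> 'b) set) \<Rightarrow> ('a \<Rightarrow> 'b) \<Rightarrow> bool"
  where
  "coalgebra_morphism X e Y e' f \<longleftrightarrow>
     lip_morphism X Y f \<and> (\<forall>x\<in>pts X. e' (f x) = tensor_map Y f (e x))"

text \<open>Finality of a coalgebra \<open>(Y, e')\<close>, tested on the coalgebras whose carrier is a subset of the
  type \<open>'u\<close>. That \<open>(Y, e')\<close> is itself a coalgebra is not part of the predicate, so a negated
  instance says that some coalgebra fails to have exactly one morphism to \<open>(Y, e')\<close>.\<close>

definition final_coalgebra ::
    "'u itself \<Rightarrow> 'b tri_space \<Rightarrow> ('b \<Rightarrow> (idx \<times> 'b) set) \<Rightarrow> bool" where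
  "final_coalgebra _ Y e' \<longleftrightarrow>
     (\<forall>(X :: 'u tri_space) e. coalgebra X e \<longrightarrow> (\<exists>!f. coalgebra_morphism X e Y e' f))"

section \<open>The colimit \<open>G\<close>\<close>

text \<open>All the \<open>M\<^sup>n \<otimes> I\<close> have to live in one HOL type: \<open>Leaf\<close> embeds \<open>I\<close>, and \<open>node\<close> embeds the
  equivalence classes of pairs over \<open>itpt\<close> (they are finite) into \<open>itpt\<close> again.\<close>

datatype corner = CT | CL | CR

datatype itpt = Leaf corner | Node "(idx \<times> itpt) fset"

definition node :: "(idx \<times> itpt) set \<Rightarrow> itpt" where
  "node U = Node (Abs_fset U)"

definition relabel :: "('a \<Rightarrow> 'b) \<Rightarrow> 'a tri_space \<Rightarrow> 'b tri_space" where
  "relabel j X =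
     \<lparr> pts = j ` pts X,
       mdst = (\<lambda>u v. mdst X (inv_into (pts X) j u) (inv_into (pts X) j v)),
       ptT = j (ptT X), ptL = j (ptL X), ptR = j (ptR X) \<rparr>"

definition I_space :: "corner tri_space" where
  "I_space = \<lparr> pts = UNIV, mdst = (\<lambda>x y. if x = y then 0 else 1), ptT = CT, ptL = CL, ptR = CR \<rparr>"

primrec iter :: "nat \<Rightarrow> itpt tri_space" where
  "iter 0 = relabel Leaf I_space"
| "iter (Suc n) = relabel node (tensor (iter n))"

primrec bang_idx :: "corner \<Rightarrow> idx" where
  "bang_idx CT = Ma" | "bang_idx CL = Mb" | "bang_idx CR = Mc"

primrec chain :: "nat \<Rightarrow> itpt \<Rightarrow> itpt" where
  "chain 0 = (\<lambda>u. let t = inv_into UNIV Leaf u in node (tens (iter 0) (bang_idx t) (Leaf t)))"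
| "chain (Suc n) =
     (\<lambda>u. node (tensor_map (iter (Suc n)) (chain n) (inv_into (pts (tensor (iter n))) node u)))"

definition iter_sum :: "(nat \<times> itpt) set" where
  "iter_sum = (SIGMA n:UNIV. pts (iter n))"

definition colim_rel :: "((nat \<times> itpt) \<times> (nat \<times> itpt)) set" where
  "colim_rel = equiv_gen iter_sum {((n, u), (Suc n, chain n u)) |n u. u \<in> pts (iter n)}"

definition G_space :: "(nat \<times> itpt) set tri_space" where
  "G_space =
     \<lparr> pts = iter_sum // colim_rel,
       mdst = dist_on (iter_sum // colim_rel)
         (\<lambda>U V. the_elem {mdst (iter p) u v |p u v. (p, u) \<in> U \<and> (p, v) \<in> V}),
       ptT = colim_rel `` {(0, Leaf CT)},
       ptL = colim_rel `` {(0, Leaf CL)},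
       ptR = colim_rel `` {(0, Leaf CR)} \<rparr>"

definition g_map :: "(idx \<times> (nat \<times> itpt) set) set \<Rightarrow> (nat \<times> itpt) set" where
  "g_map W = (\<Union>(m, U)\<in>W. \<Union>(n, u)\<in>U. colim_rel `` {(Suc n, node (tens (iter n) m u))})"

section \<open>Its Cauchy completion \<open>S\<close>\<close>

definition cauchy_seqs :: "'a tri_space \<Rightarrow> (nat \<Rightarrow> 'a) set" where
  "cauchy_seqs X = {x. Metric_space.MCauchy (pts X) (mdst X) x}"

definition cauchy_rel :: "'a tri_space \<Rightarrow> ((nat \<Rightarrow> 'a) \<times> (nat \<Rightarrow> 'a)) set" where
  "cauchy_rel X =
     {(x, y). x \<in> cauchy_seqs X \<and> y \<in> cauchy_seqs X \<and> (\<lambda>n. mdst X (x n) (y n)) \<longlonglongrightarrow> 0}"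

definition completion :: "'a tri_space \<Rightarrow> (nat \<Rightarrow> 'a) set tri_space" where
  "completion X =
     \<lparr> pts = cauchy_seqs X // cauchy_rel X,
       mdst = dist_on (cauchy_seqs X // cauchy_rel X)
         (\<lambda>U V. the_elem {lim (\<lambda>n. mdst X (x n) (y n)) |x y. x \<in> U \<and> y \<in> V}),
       ptT = cauchy_rel X `` {\<lambda>_. ptT X},
       ptL = cauchy_rel X `` {\<lambda>_. ptL X},
       ptR = cauchy_rel X `` {\<lambda>_. ptR X} \<rparr>"

definition S_space :: "(nat \<Rightarrow> (nat \<times> itpt) set) set tri_space" where
  "S_space = completion G_space"

definition s_map ::
    "(idx \<times> (nat \<Rightarrow> (nat \<times> itpt) set) set) set \<Rightarrow> (nat \<Rightarrow> (nat \<times> itpt) set) set" where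
  "s_map W =
     (\<Union>(m, \<xi>)\<in>W. \<Union>x\<in>\<xi>. cauchy_rel G_space `` {\<lambda>n. g_map (tens G_space m (x n))})"

definition S_coalg ::
    "(nat \<Rightarrow> (nat \<times> itpt) set) set \<Rightarrow> (idx \<times> (nat \<Rightarrow> (nat \<times> itpt) set) set) set" where
  "S_coalg = restrict (inv_into (pts (tensor S_space)) s_map) (pts S_space)"

section \<open>The Sierpinski gasket\<close>

text \<open>The distance of the library on \<^typ>\<open>real \<times> real\<close> is the Euclidean one.\<close>

primrec gasket_map :: "idx \<Rightarrow> real \<times> real \<Rightarrow> real \<times> real" where
  "gasket_map Ma p = (fst p / 2 + 1/4, snd p / 2 + sqrt 3 / 4)"
| "gasket_map Mb p = (fst p / 2, snd p / 2)"
| "gasket_map Mc p = (fst p / 2 + 1/2, snd p / 2)"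

definition gasket :: "(real \<times> real) set" where
  "gasket = (THE K. compact K \<and> K \<noteq> {} \<and>
     K = gasket_map Ma ` K \<union> gasket_map Mb ` K \<union> gasket_map Mc ` K)"

definition gasket_space :: "(real \<times> real) tri_space" where
  "gasket_space =
     \<lparr> pts = gasket, mdst = dist, ptT = (1/2, sqrt 3 / 2), ptL = (0, 0), ptR = (1, 0) \<rparr>"

definition tau :: "(idx \<times> real \<times> real) set \<Rightarrow> real \<times> real" where
  "tau W = the_elem {gasket_map m x |m x. (m, x) \<in> W}"

definition gasket_coalg :: "real \<times> real \<Rightarrow> (idx \<times> real \<times> real) set" where
  "gasket_coalg = restrict (inv_into (pts (tensor gasket_space)) tau) (pts gasket_space)"

end

theory Submission
  imports Defs
begin

text \<open>Take a coalgebra on points \<open>T = x\<^sub>0\<close>, \<open>x\<^sub>1\<close>, \<open>x\<^sub>2\<close>, \dots converging to \<open>L\<close>, with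
  \<open>x\<^sub>n\<close> at distance \<open>4\<^sup>-\<^sup>n\<close> from \<open>L\<close>, and \<open>R\<close>; its structure sends \<open>x\<^sub>n\<^sub>+\<^sub>1\<close> to
  \<open>b \<otimes> x\<^sub>n\<close> and is Lipschitz with constant \<open>2\<close>. A coalgebra morphism to \<open>S\<close> or to the gasket has to
  send \<open>x\<^sub>n\<close> to the point with address \<open>b\<^sup>nT\<close>, whose distance from \<open>L\<close> is \<open>2\<^sup>-\<^sup>n\<close>, so it
  cannot be Lipschitz. All that is used of the target is that the inverse of its structure map
  halves distances on the copy \<open>b\<close>.\<close>

section \<open>A coalgebra of contracting points\<close>

lemma tensor_rel_invariant:
  assumes "(p, q) \<in> tensor_rel X" and "\<And>p q. (p, q) \<in> glue X \<Longrightarrow> h p = h q"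
  shows "h p = h q"
proof -
  have "(p, q) \<in> (glue X \<union> (glue X)\<inverse>)\<^sup>*"
    using assms(1) by (simp add: tensor_rel_def equiv_gen_def)
  then show ?thesis
    by (induction rule: rtrancl_induct) (use assms(2) in fastforce)+
qed

lemma tens_self: "x \<in> pts X \<Longrightarrow> (m, x) \<in> tens X m x"
  by (simp add: tens_def tensor_rel_def equiv_gen_def)

lemma pts_tensor: "pts (tensor X) = {tens X m x |m x. x \<in> pts X}"
  by (auto simp: tensor_def quotient_def tens_def)

lemma tens_in_pts: "x \<in> pts X \<Longrightarrow> tens X m x \<in> pts (tensor X)"
  by (auto simp: pts_tensor)

text \<open>Maps out of \<open>M \<otimes> X\<close> are written as unions over representatives;
  once the values agree on the glue pairs, all members of the union coincide. This evaluates
  \<open>tensor_map\<close>, \<open>tau\<close>, \<open>g_map\<close> and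
  \<open>s_map\<close>.\<close>

lemma UN_tens:
  assumes "x \<in> pts X" and "\<And>p q. (p, q) \<in> glue X \<Longrightarrow> h p = h q"
  shows "(\<Union>p\<in>tens X m x. h p) = h (m, x)"
proof -
  have "h p = h (m, x)" if "p \<in> tens X m x" for p
    using tensor_rel_invariant[of "(m, x)" p X h] that assms(2) by (auto simp: tens_def)
  then show ?thesis using tens_self[OF assms(1)] by blast
qed

lemma tens_glue:
  assumes "ptT X \<in> pts X" "ptL X \<in> pts X" "ptR X \<in> pts X"
  shows "tens X Mb (ptT X) = tens X Ma (ptL X)" "tens X Ma (ptR X) = tens X Mc (ptT X)"
    "tens X Mc (ptL X) = tens X Mb (ptR X)"
  unfolding tens_def
  by (rule equiv_class_eq[OF equiv_tensor_rel],
      use assms in \<open>force simp: tensor_rel_def equiv_gen_def glue_def\<close>)+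

lemma tensor_map_tens:
  assumes "f \<in> pts X \<rightarrow> pts Y" "ptT X \<in> pts X" "ptL X \<in> pts X" "ptR X \<in> pts X"
    "f (ptT X) = ptT Y" "f (ptL X) = ptL Y" "f (ptR X) = ptR Y" "x \<in> pts X"
  shows "tensor_map Y f (tens X m x) = tens Y m (f x)"
proof -
  have Y: "ptT Y \<in> pts Y" "ptL Y \<in> pts Y" "ptR Y \<in> pts Y"
    using assms by (metis funcset_mem)+
  have "(\<Union>p\<in>tens X m x. (\<lambda>(m, x). tens Y m (f x)) p) = (\<lambda>(m, x). tens Y m (f x)) (m, x)"
    by (rule UN_tens) (use assms tens_glue[OF Y] in \<open>auto simp: glue_def\<close>)
  then show ?thesis by (simp add: tensor_map_def)
qed

section \<open>Transport of structure along an injection\<close>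

lemma tri_metric_relabel:
  assumes X: "tri_metric X" and j: "inj_on j (pts X)"
  shows "tri_metric (relabel j X)"
proof -
  interpret Metric_space "pts X" "mdst X" using X by (simp add: tri_metric_def)
  have inv: "inv_into (pts X) j (j x) = x" if "x \<in> pts X" for x using j that by simp
  have "Metric_space (j ` pts X) (\<lambda>u v. mdst X (inv_into (pts X) j u) (inv_into (pts X) j v))"
    by standard (auto simp: commute inv intro: triangle)
  then show ?thesis
    using tri_metricD[OF X] X by (auto simp: tri_metric_def relabel_def inv)
qed

lemma relabel_simps [simp]:
  "pts (relabel j X) = j ` pts X" "ptT (relabel j X) = j (ptT X)"
  "ptL (relabel j X) = j (ptL X)" "ptR (relabel j X) = j (ptR X)"
  by (simp_all add: relabel_def)

lemma mdst_relabel: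
  "inj_on j (pts X) \<Longrightarrow> x \<in> pts X \<Longrightarrow> y \<in> pts X \<Longrightarrow>
    mdst (relabel j X) (j x) (j y) = mdst X x y"
  by (simp add: relabel_def)

text \<open>The points \<open>L\<close>, \<open>R\<close>, \<open>x\<^sub>0 = T\<close>, \<open>x\<^sub>1\<close>, \<open>x\<^sub>2\<close>, \dots are numbered consecutively and placed in
  the plane with the maximum metric, \<open>x\<^sub>n\<close> at \<open>(4\<^sup>-\<^sup>n, 0)\<close>.\<close>

definition contr_x :: "nat \<Rightarrow> real" where
  "contr_x i = (if i \<le> 1 then 0 else 1 / 4 ^ (i - 2))"

definition contr_y :: "nat \<Rightarrow> real" where
  "contr_y i = (if i = 1 then 1 else 0)"

text \<open>The maximum norm puts \<open>R = (0, 1)\<close> at distance exactly 1 from every other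
  point. The Euclidean norm would put it at distance \<open>sqrt 2\<close> from
  \<open>T = (1, 0)\<close>, beyond the bound 1.\<close>

definition contr_space :: "nat tri_space" where
  "contr_space = \<lparr> pts = UNIV, mdst = (\<lambda>i j. max \<bar>contr_x i - contr_x j\<bar> \<bar>contr_y i - contr_y j\<bar>),
     ptT = 2, ptL = 0, ptR = 1 \<rparr>"

text \<open>The structure map of the coalgebra is
  \<open>i \<mapsto> contr_idx i \<otimes> contr_next i\<close>. Corners must go to corners, so
  \<open>contr_next\<close> fixes the numbers 0, 1, 2 of \<open>L\<close>, \<open>R\<close>,
  \<open>T\<close>; the point \<open>x\<^sub>n\<close> has number \<open>n + 2\<close>.\<close>

definition contr_idx :: "nat \<Rightarrow> idx" where
  "contr_idx i = (if i = 1 then Mc else if i = 2 then Ma else Mb)"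

definition contr_next :: "nat \<Rightarrow> nat" where
  "contr_next i = (if i \<le> 2 then i else i - 1)"

lemma contr_x_bounds: "0 \<le> contr_x i" "contr_x i \<le> 1"
  by (auto simp: contr_x_def)

text \<open>Passing from \<open>x\<^sub>n\<^sub>+\<^sub>1\<close> to \<open>x\<^sub>n\<close>
  stretches by 4, while copy \<open>b\<close> of \<open>M \<otimes> X\<close> halves distances; this
  gives the Lipschitz constant 2.\<close>

lemma contr_x_next: "contr_idx i = Mb \<Longrightarrow> contr_x (contr_next i) = 4 * contr_x i"
proof (cases "i \<le> 2")
  case False
  then obtain k where "i = Suc (Suc (Suc k))"
    by (intro that[of "i - 3"]) simp
  then show ?thesis by (simp add: contr_x_def contr_next_def)
qed (auto simp: contr_x_def contr_next_def contr_idx_def split: if_splits)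

lemma contr_idx_Mb: "contr_idx i = Mb \<Longrightarrow> i = 0 \<or> i \<ge> 3"
  by (auto simp: contr_idx_def split: if_splits)

lemma contr_x_le_quarter: "contr_idx i = Mb \<Longrightarrow> contr_x i \<le> 1 / 4"
  using contr_x_next[of i] contr_x_bounds(2)[of "contr_next i"] by linarith

lemma contr_y_Mb: "contr_idx i = Mb \<Longrightarrow> contr_y i = 0" "contr_idx i = Mb \<Longrightarrow> contr_y (contr_next i) = 0"
  using contr_idx_Mb[of i] by (auto simp: contr_y_def contr_next_def)

lemma tri_metric_contr_space: "tri_metric contr_space"
proof -
  \<comment> \<open>\<open>contr_x\<close> separates all points except 0 and 1, which
    \<open>contr_y\<close> tells apart.\<close>
  have inj: "i = j" if "contr_x i = contr_x j" "contr_y i = contr_y j" for i j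
  proof -
    have "i = 1 \<longleftrightarrow> j = 1" using that(2) by (auto simp: contr_y_def split: if_splits)
    moreover have "i - 2 = j - 2" "i \<le> 1 \<longleftrightarrow> j \<le> 1"
      using that(1) by (auto simp: contr_x_def split: if_splits)
    ultimately show ?thesis by linarith
  qed
  have "Metric_space UNIV (\<lambda>i j. max \<bar>contr_x i - contr_x j\<bar> \<bar>contr_y i - contr_y j\<bar>)"
  proof
    fix i j
    have "max \<bar>contr_x i - contr_x j\<bar> \<bar>contr_y i - contr_y j\<bar> = 0 \<longleftrightarrow> contr_x i = contr_x j \<and> contr_y i = contr_y j"
      by linarith
    then show "max \<bar>contr_x i - contr_x j\<bar> \<bar>contr_y i - contr_y j\<bar> = 0 \<longleftrightarrow> i = j"
      using inj by blast
  qed auto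
  moreover have "max \<bar>contr_x i - contr_x j\<bar> \<bar>contr_y i - contr_y j\<bar> \<le> 1" for i j
    using contr_x_bounds[of i] contr_x_bounds[of j] by (auto simp: contr_y_def)
  ultimately show ?thesis
    by (auto simp: tri_metric_def contr_space_def contr_x_def contr_y_def)
qed

text \<open>Here \<open>i\<close> is \<open>T\<close> or \<open>R\<close>. The point closest to
  \<open>T\<close> is \<open>x\<^sub>1\<close>, at distance \<open>1 - 1/4\<close>. As no distance
  exceeds 1, the bound 3/4 makes the Lipschitz condition with constant 2 automatic for such
  pairs.\<close>

lemma contr_dist_ge:
  assumes "i \<noteq> j" "contr_idx i \<noteq> Mb"
  shows "3 / 4 \<le> mdst contr_space i j"
proof -
  have i: "i = 1 \<or> i = 2" using assms(2) by (auto simp: contr_idx_def split: if_splits)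
  show ?thesis
  proof (cases "contr_idx j = Mb")
    case True
    then show ?thesis
      using i contr_x_le_quarter[of j] contr_y_Mb[of j]
      by (auto simp: contr_space_def le_max_iff_disj contr_x_def[of 2] contr_y_def[of "Suc 0"])
  next
    case False
    then have "j = 1 \<or> j = 2" by (auto simp: contr_idx_def split: if_splits)
    then show ?thesis using i assms(1) by (auto simp: contr_space_def contr_x_def contr_y_def)
  qed
qed

text \<open>Existence of a morphism fails: a morphism \<open>f\<close> with Lipschitz constant
  \<open>K\<close> would satisfy \<open>2^-n \<le> d(f x\<^sub>n, L) \<le> K * 4^-n\<close>, hence
  \<open>2^n \<le> K\<close> for all \<open>n\<close>. An infinite type \<open>'u\<close> contains a
  copy of the naturals, which carries the coalgebra.\<close>

lemma not_final_if_expanding: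
  fixes Y :: "'b tri_space"
  assumes inf: "infinite (UNIV :: 'u set)"
    and TL: "mdst Y (ptT Y) (ptL Y) = 1"
    and expand: "\<And>x x' y y'. x \<in> pts Y \<Longrightarrow> x' \<in> pts Y \<Longrightarrow> y \<in> pts Y \<Longrightarrow> y' \<in> pts Y \<Longrightarrow>
      e' y = tens Y Mb x \<Longrightarrow> e' y' = tens Y Mb x' \<Longrightarrow> mdst Y x x' \<le> 2 * mdst Y y y'"
  shows "\<not> final_coalgebra TYPE('u) Y e'"
proof
  assume fin: "final_coalgebra TYPE('u) Y e'"
  obtain \<iota> :: "nat \<Rightarrow> 'u" where \<iota>: "inj \<iota>"
    using inf by (meson infinite_countable_subset)
  define X where "X = relabel \<iota> contr_space"
  have \<iota>': "inj_on \<iota> (pts contr_space)" using \<iota> by (simp add: contr_space_def)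
  have X: "tri_metric X"
    unfolding X_def by (rule tri_metric_relabel[OF tri_metric_contr_space \<iota>'])
  have ptsX: "pts X = range \<iota>" and ptX: "ptT X = \<iota> 2" "ptL X = \<iota> 0" "ptR X = \<iota> 1"
    by (simp_all add: X_def contr_space_def)
  have dX: "mdst X (\<iota> i) (\<iota> j) = mdst contr_space i j" for i j
    unfolding X_def by (rule mdst_relabel[OF \<iota>']) (simp_all add: contr_space_def)
  have inv: "inv \<iota> (\<iota> i) = i" for i using \<iota> by simp
  define e where "e = restrict (\<lambda>u. tens X (contr_idx (inv \<iota> u)) (\<iota> (contr_next (inv \<iota> u)))) (pts X)"
  have e: "e (\<iota> i) = tens X (contr_idx i) (\<iota> (contr_next i))" for i
    using ptsX by (simp add: e_def inv)
  have lip: "mdst (tensor X) (e (\<iota> i)) (e (\<iota> j)) \<le> 2 * mdst X (\<iota> i) (\<iota> j)" for i j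
  proof -
    have E: "mdst (tensor X) (e (\<iota> i)) (e (\<iota> j)) =
        pair_dist X (contr_idx i, \<iota> (contr_next i)) (contr_idx j, \<iota> (contr_next j))"
      unfolding e by (rule tensor_dist[OF X]) (auto simp: ptsX)
    \<comment> \<open>Within copy \<open>b\<close>, stretching by 4 and halving gives equality. For
      distinct points not both in copy \<open>b\<close> the left side is at most 1 and the right
      side at least \<open>2 * 3/4\<close>.\<close>
    consider "contr_idx i = Mb" "contr_idx j = Mb" | "i = j"
      | "i \<noteq> j" "contr_idx i \<noteq> Mb \<or> contr_idx j \<noteq> Mb" by blast
    then show ?thesis
    proof cases
      case 1
      have "\<bar>4 * a - 4 * b\<bar> = 4 * \<bar>a - b\<bar>" for a b :: real by (simp add: abs_if)
      then show ?thesis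
        unfolding E 1 pair_dist.simps dX
        by (simp add: contr_space_def contr_x_next[OF 1(1)] contr_x_next[OF 1(2)] contr_y_Mb[OF 1(1)] contr_y_Mb[OF 1(2)])
    next
      case 2
      then show ?thesis unfolding E
        by (cases "contr_idx j") (simp_all add: dX contr_space_def)
    next
      case 3
      have "3 / 4 \<le> mdst contr_space i j"
        using contr_dist_ge[of i j] contr_dist_ge[of j i] 3
        by (auto simp: contr_space_def abs_minus_commute)
      moreover have "mdst (tensor X) (e (\<iota> i)) (e (\<iota> j)) \<le> 1"
        unfolding E by (rule pair_dist_bounds(2)[OF X]) (auto simp: ptsX)
      ultimately show ?thesis by (simp add: dX)
    qed
  qed
  have "lip_morphism X (tensor X) e"
    unfolding lip_morphism_def
  proof (intro conjI exI[of _ 2] ballI)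
    show "e \<in> pts X \<rightarrow>\<^sub>E pts (tensor X)"
      unfolding e_def by (rule restrict_PiE_iff[THEN iffD2]) (auto intro: tens_in_pts simp: ptsX)
    show "e (ptT X) = ptT (tensor X)" "e (ptL X) = ptL (tensor X)" "e (ptR X) = ptR (tensor X)"
      unfolding ptX e by (simp_all add: tensor_def ptX contr_idx_def contr_next_def)
  qed (use lip ptsX in auto)
  then have "coalgebra X e" using X by (simp add: coalgebra_def)
  then obtain f where "coalgebra_morphism X e Y e' f"
    using fin unfolding final_coalgebra_def by blast
  then obtain K where f: "f \<in> pts X \<rightarrow>\<^sub>E pts Y" "f (ptT X) = ptT Y" "f (ptL X) = ptL Y"
      "f (ptR X) = ptR Y" "\<And>x. x \<in> pts X \<Longrightarrow> e' (f x) = tensor_map Y f (e x)"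
    and K: "\<And>x y. x \<in> pts X \<Longrightarrow> y \<in> pts X \<Longrightarrow> mdst Y (f x) (f y) \<le> K * mdst X x y"
    unfolding coalgebra_morphism_def lip_morphism_def by blast
  have in_Y: "f (\<iota> i) \<in> pts Y" for i using f(1) ptsX by auto
  have e': "e' (f (\<iota> i)) = tens Y (contr_idx i) (f (\<iota> (contr_next i)))" for i
  proof -
    have "e' (f (\<iota> i)) = tensor_map Y f (tens X (contr_idx i) (\<iota> (contr_next i)))"
      using f(5)[of "\<iota> i"] by (simp add: ptsX e)
    also have "\<dots> = tens Y (contr_idx i) (f (\<iota> (contr_next i)))"
      by (rule tensor_map_tens) (use f(1-4) tri_metricD(1-3)[OF X] in \<open>auto simp: ptsX\<close>)
    finally show ?thesis .
  qed
  \<comment> \<open>\<open>\<iota> (n + 2)\<close> is \<open>x\<^sub>n\<close> and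
    \<open>\<iota> 0\<close> is \<open>L\<close>. The induction starts from
    \<open>d(T, L) = 1\<close>; in the step, \<open>x\<^sub>n\<^sub>+\<^sub>1\<close> and
    \<open>L\<close> are sent to \<open>b \<otimes> x\<^sub>n\<close> and
    \<open>b \<otimes> L\<close>, so \<open>expand\<close> loses a factor of at most 2.\<close>
  have "1 \<le> 2 ^ n * mdst Y (f (\<iota> (n + 2))) (f (\<iota> 0))" for n
  proof (induction n)
    case 0
    then show ?case using TL f ptX by (simp add: numeral_2_eq_2)
  next
    case (Suc n)
    have "mdst Y (f (\<iota> (n + 2))) (f (\<iota> 0)) \<le> 2 * mdst Y (f (\<iota> (Suc n + 2))) (f (\<iota> 0))"
      by (rule expand[OF in_Y in_Y in_Y in_Y]) (simp_all add: e' contr_idx_def contr_next_def)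
    then have "2 ^ n * mdst Y (f (\<iota> (n + 2))) (f (\<iota> 0)) \<le>
        2 ^ n * (2 * mdst Y (f (\<iota> (Suc n + 2))) (f (\<iota> 0)))"
      by (rule mult_left_mono) simp
    from order_trans[OF Suc this] show ?case by (simp add: ac_simps)
  qed
  \<comment> \<open>In the source, \<open>x\<^sub>n\<close> has distance \<open>4^-n\<close> from
    \<open>L\<close>.\<close>
  moreover have "mdst Y (f (\<iota> (n + 2))) (f (\<iota> 0)) \<le> K / 4 ^ n" for n
    using K[of "\<iota> (n + 2)" "\<iota> 0"] by (simp add: ptsX dX contr_space_def contr_x_def contr_y_def)
  ultimately have "1 \<le> 2 ^ n * (K / 4 ^ n)" for n
    by (meson mult_left_mono order_trans zero_le_numeral zero_le_power)
  then have "2 ^ n \<le> K" for n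
  proof -
    have "(4::real) ^ n = 2 ^ n * 2 ^ n" by (simp flip: power_mult_distrib)
    then show ?thesis using \<open>1 \<le> 2 ^ n * (K / 4 ^ n)\<close> by (simp add: field_simps)
  qed
  then show False
    using real_arch_pow[of 2 K] by (meson linorder_not_less one_less_numeral_iff semiring_norm(76))
qed

section \<open>The Sierpinski gasket\<close>

lemma dist_gasket_map: "dist (gasket_map m x) (gasket_map m y) = dist x y / 2"
proof -
  have "sqrt ((a / 2)\<^sup>2 + (b / 2)\<^sup>2) = sqrt (a\<^sup>2 + b\<^sup>2) / 2" for a b :: real
    by (simp add: power_divide real_sqrt_divide flip: add_divide_distrib)
  from this[of "fst x - fst y" "snd x - snd y"] show ?thesis
    by (cases m) (simp_all add: dist_prod_def dist_real_def diff_divide_distrib)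
qed

lemma continuous_gasket_map: "continuous_on S (gasket_map m)"
proof -
  have "1-lipschitz_on S (gasket_map m)"
    by (rule lipschitz_onI) (auto simp: dist_gasket_map)
  then show ?thesis by (rule lipschitz_on_continuous_on)
qed

lemma inj_gasket_map: "inj (gasket_map m)"
  using dist_gasket_map[of m] by (intro injI) (metis dist_eq_0_iff zero_eq_1_divide_iff divide_eq_0_iff zero_neq_numeral)

text \<open>The Hutchinson operator of the three similitudes.\<close>

definition hutch :: "(real \<times> real) set \<Rightarrow> (real \<times> real) set" where
  "hutch K = (\<Union>m. gasket_map m ` K)"

lemma UNIV_idx: "(UNIV :: idx set) = {Ma, Mb, Mc}"
  using idx.exhaust by blast

text \<open>Pigeonhole. It allows one copy to be fixed along a sequence, both for the attractor and
  for the surjectivity of \<open>s_map\<close>.\<close>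

lemma idx_infinite_fibre:
  fixes m :: "nat \<Rightarrow> idx"
  obtains i where "infinite {n. m n = i}"
proof -
  have "finite (UNIV :: idx set)" by (simp add: UNIV_idx)
  then have "finite (range m)" by (rule finite_subset[OF subset_UNIV])
  then show ?thesis
    using inf_img_fin_dom[of m UNIV] that by (auto simp: vimage_def)
qed

lemma hutch_eq: "hutch K = gasket_map Ma ` K \<union> gasket_map Mb ` K \<union> gasket_map Mc ` K"
  by (auto simp: hutch_def UNIV_idx)

lemma compact_hutch: "compact K \<Longrightarrow> compact (hutch K)"
  unfolding hutch_eq by (intro compact_Un compact_continuous_image continuous_gasket_map)

text \<open>A point of \<open>K\<close> farthest from \<open>K'\<close> is the image of another
  point of \<open>K\<close> under a map that halves distances and sends \<open>K'\<close> into
  itself. So the largest distance is at most half of itself, and vanishes. Used in both directions,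
  this gives uniqueness.\<close>

lemma hutch_fixed_subset:
  assumes "compact K" "K = hutch K" "compact K'" "K' \<noteq> {}" "K' = hutch K'"
  shows "K \<subseteq> K'"
proof (cases "K = {}")
  case False
  have "continuous_on K (\<lambda>x. infdist x K')" by (intro continuous_intros)
  then obtain x0 where x0: "x0 \<in> K" "\<And>x. x \<in> K \<Longrightarrow> infdist x K' \<le> infdist x0 K'"
    using continuous_attains_sup[OF assms(1) False] by blast
  obtain m x1 where x1: "x1 \<in> K" "x0 = gasket_map m x1"
    using x0(1) assms(2) unfolding hutch_def by blast
  obtain k where k: "k \<in> K'" "infdist x1 K' = dist x1 k"
    using infdist_attains_inf[of K' x1] assms compact_imp_closed by blast
  have "gasket_map m k \<in> K'" using k(1) assms(5) by (auto simp: hutch_def)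
  then have "infdist x0 K' \<le> dist x1 k / 2"
    using infdist_le[of _ K' x0] dist_gasket_map x1(2) by metis
  also have "\<dots> \<le> infdist x0 K' / 2" using k(2) x0(2)[OF x1(1)] by simp
  finally have "infdist x0 K' \<le> 0" by simp
  then have "infdist x K' = 0" if "x \<in> K" for x
    using x0(2)[OF that] infdist_nonneg[of x K'] by linarith
  then show ?thesis
    using in_closed_iff_infdist_zero[of K'] assms compact_imp_closed by blast
qed simp

text \<open>The unit square is mapped into itself, so its iterates form a decreasing sequence of
  nonempty compact sets, and their intersection is the fixed point.\<close>

lemma hutch_fixed_exists: "\<exists>K. compact K \<and> K \<noteq> {} \<and> K = hutch K"
proof -
  define B :: "(real \<times> real) set" where "B = {0..1} \<times> {0..1}"
  define A where "A n = (hutch ^^ n) B" for n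
  have mono: "mono hutch" unfolding hutch_def by (rule monoI) blast
  \<comment> \<open>This keeps the second coordinate of \<open>gasket_map Ma p\<close> at most 1,
    since \<open>1/2 + sqrt 3 / 4 \<le> 1\<close>.\<close>
  have "sqrt 3 \<le> 2" by (rule real_le_lsqrt) auto
  then have "gasket_map m p \<in> B" if "p \<in> B" for m p
    using that by (cases m) (auto simp: B_def)
  then have "hutch B \<subseteq> B" by (auto simp: hutch_def)
  then have "(hutch ^^ Suc n) B \<subseteq> (hutch ^^ n) B" for n
    by (induction n) (simp_all add: monoD[OF mono])
  then have dec: "A n \<subseteq> A k" if "k \<le> n" for k n
    unfolding A_def using lift_Suc_antimono_le[of "\<lambda>n. (hutch ^^ n) B"] that by blast
  have cpt: "compact (A n)" for n
    unfolding A_def by (induction n) (auto simp: B_def intro: compact_Times compact_hutch)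
  have ne: "A n \<noteq> {}" for n
    unfolding A_def by (induction n) (auto simp: B_def hutch_def)
  define K where "K = \<Inter>(range A)"
  have "K \<noteq> {}"
    unfolding K_def using compact_nest[of A] cpt ne dec by simp
  moreover have "compact K"
    unfolding K_def using compact_Inter[of "range A"] cpt by auto
  moreover have "K = hutch K"
  proof
    have "hutch K \<subseteq> A (Suc n)" for n
    proof -
      have "hutch K \<subseteq> hutch (A n)" by (rule monoD[OF mono]) (auto simp: K_def)
      then show ?thesis by (simp add: A_def)
    qed
    then have "hutch K \<subseteq> A n" for n using dec[of n "Suc n"] by force
    then show "hutch K \<subseteq> K" by (auto simp: K_def)
    \<comment> \<open>The similitude whose image of \<open>A n\<close> contains \<open>y\<close> may
      change with \<open>n\<close>, but one of them occurs infinitely often. By injectivity its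
      preimage of \<open>y\<close> is a single point, which lies in infinitely many
      \<open>A n\<close> and hence, the sequence being decreasing, in all.\<close>
    show "K \<subseteq> hutch K"
    proof
      fix y assume "y \<in> K"
      then have "\<forall>n. y \<in> hutch (A n)"
        unfolding K_def using A_def by (metis InterE funpow.simps(2) o_apply rangeI)
      then obtain m where m: "\<And>n. y \<in> gasket_map (m n) ` A n"
        unfolding hutch_def by (simp only: UN_iff UNIV_I bex_UNIV) metis
      obtain i where i: "infinite {n. m n = i}"
        using idx_infinite_fibre by blast
      then obtain n0 where "m n0 = i" using not_finite_existsD by blast
      then obtain x where x: "y = gasket_map i x" using m[of n0] by blast
      have "x \<in> A k" for k
      proof -
        obtain n where n: "n \<ge> k" "m n = i"
          using i unfolding infinite_nat_iff_unbounded_le by blast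
        then have "x \<in> A n" using m[of n] x inj_gasket_map[of i] by (auto dest: injD)
        then show ?thesis using dec n(1) by blast
      qed
      then show "y \<in> hutch K" using x by (auto simp: K_def hutch_def)
    qed
  qed
  ultimately show ?thesis by blast
qed

text \<open>\<open>gasket\<close> is a definite description, so its equation becomes available only
  through existence and uniqueness.\<close>

lemma gasket_fixed: "gasket = hutch gasket"
proof -
  have "\<exists>!K. compact K \<and> K \<noteq> {} \<and> K = hutch K"
    using hutch_fixed_exists hutch_fixed_subset by (meson subset_antisym)
  from theI'[OF this] show ?thesis
    unfolding gasket_def hutch_eq by blast
qed

section \<open>The coalgebra on the gasket\<close>

lemma pts_gasket_space [simp]: "pts gasket_space = gasket"
  by (simp add: gasket_space_def)

lemma tau_tens:
  assumes "x \<in> gasket"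
  shows "tau (tens gasket_space m x) = gasket_map m x"
proof -
  \<comment> \<open>As a union of singletons the set falls under \<open>UN_tens\<close>; on glue
    pairs the similitudes agree because the small triangles meet at the edge midpoints.\<close>
  have "{gasket_map n z |n z. (n, z) \<in> tens gasket_space m x} =
      (\<Union>p\<in>tens gasket_space m x. (\<lambda>(n, z). {gasket_map n z}) p)"
    by auto
  also have "\<dots> = {gasket_map m x}"
    using assms by (subst UN_tens) (auto simp: gasket_space_def glue_def)
  finally show ?thesis by (simp add: tau_def)
qed

text \<open>\<open>gasket_coalg\<close> chooses preimages under \<open>tau\<close>. The fixed point
  equation makes \<open>tau\<close> surjective onto the gasket, so the choice is a right
  inverse.\<close>

lemma tau_gasket_coalg:
  assumes "y \<in> gasket"
  shows "tau (gasket_coalg y) = y"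
proof -
  obtain m x where "x \<in> gasket" "y = gasket_map m x"
    using assms gasket_fixed unfolding hutch_def by blast
  then have "y \<in> tau ` pts (tensor gasket_space)"
    using tau_tens[of x m] tens_in_pts[of x gasket_space m]
    by (metis image_eqI pts_gasket_space)
  then show ?thesis
    using assms by (simp add: gasket_coalg_def f_inv_into_f)
qed

lemma gasket_not_final:
  assumes "infinite (UNIV :: 'u set)"
  shows "\<not> final_coalgebra TYPE('u) gasket_space gasket_coalg"
proof (rule not_final_if_expanding[OF assms])
  show "mdst gasket_space (ptT gasket_space) (ptL gasket_space) = 1"
    by (simp add: gasket_space_def dist_prod_def dist_real_def power_divide)
next
  fix x x' y y'
  assume in_G: "x \<in> pts gasket_space" "x' \<in> pts gasket_space" "y \<in> pts gasket_space"
      "y' \<in> pts gasket_space"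
    and "gasket_coalg y = tens gasket_space Mb x" "gasket_coalg y' = tens gasket_space Mb x'"
  then have "y = gasket_map Mb x" "y' = gasket_map Mb x'"
    using tau_tens tau_gasket_coalg by (metis pts_gasket_space)+
  then show "mdst gasket_space x x' \<le> 2 * mdst gasket_space y y'"
    using dist_gasket_map[of Mb x x'] by (simp add: gasket_space_def)
qed

section \<open>The colimit\<close>

lemma finite_tens: "tri_metric X \<Longrightarrow> U \<in> pts (tensor X) \<Longrightarrow> finite U"
proof -
  assume X: "tri_metric X" and "U \<in> pts (tensor X)"
  then obtain p where p: "U = tensor_rel X `` {p}"
    by (auto simp: pts_tensor tens_def)
  have "finite (insert p (fst ` glue X \<union> snd ` glue X))" by (simp add: glue_def)
  then show ?thesis
    by (rule finite_subset[rotated]) (force simp: p tensor_rel_iff[OF X])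
qed

text \<open>\<open>node\<close> passes through \<open>Abs_fset\<close>, which is faithful on finite
  sets; gluing classes are finite.\<close>

lemma inj_on_node: "tri_metric X \<Longrightarrow> inj_on node (pts (tensor X))"
  unfolding node_def
  by (rule inj_onI) (metis Abs_fset_inverse finite_tens itpt.inject(2) mem_Collect_eq)

lemma tri_metric_iter: "tri_metric (iter n)"
proof (induction n)
  case 0
  have "Metric_space UNIV (\<lambda>x y :: corner. if x = y then 0 else 1)"
    by standard auto
  then have "tri_metric I_space" by (auto simp: tri_metric_def I_space_def)
  then show ?case by (auto intro: tri_metric_relabel simp: inj_on_def)
next
  case (Suc n)
  then show ?case
    by (auto intro: tri_metric_relabel tri_metric_tensor inj_on_node)
qed

text \<open>The element \<open>m \<otimes> u\<close> of stage \<open>Suc n\<close>, for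
  \<open>u\<close> in stage \<open>n\<close>.\<close>

abbreviation nd :: "nat \<Rightarrow> idx \<Rightarrow> itpt \<Rightarrow> itpt" where
  "nd n m u \<equiv> node (tens (iter n) m u)"

lemma pts_iter_Suc: "pts (iter (Suc n)) = {nd n m u |m u. u \<in> pts (iter n)}"
  by (auto simp: pts_tensor)

lemma nd_in: "u \<in> pts (iter n) \<Longrightarrow> nd n m u \<in> pts (iter (Suc n))"
  unfolding pts_iter_Suc by blast

lemma ptT_iter_Suc: "ptT (iter (Suc n)) = nd n Ma (ptT (iter n))"
  and ptL_iter_Suc: "ptL (iter (Suc n)) = nd n Mb (ptL (iter n))"
  and ptR_iter_Suc: "ptR (iter (Suc n)) = nd n Mc (ptR (iter n))"
  by (simp_all add: tensor_def)

lemma mdst_nd: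
  assumes "u \<in> pts (iter n)" "v \<in> pts (iter n)"
  shows "mdst (iter (Suc n)) (nd n m u) (nd n k v) = pair_dist (iter n) (m, u) (k, v)"
  using assms
  by (simp add: mdst_relabel[OF inj_on_node] tri_metric_iter tens_in_pts tensor_dist)

section \<open>The chain maps are isometric embeddings\<close>

definition tri_emb :: "'a tri_space \<Rightarrow> 'b tri_space \<Rightarrow> ('a \<Rightarrow> 'b) \<Rightarrow> bool" where
  "tri_emb X Y f \<longleftrightarrow> f \<in> pts X \<rightarrow> pts Y \<and>
     f (ptT X) = ptT Y \<and> f (ptL X) = ptL Y \<and> f (ptR X) = ptR Y \<and>
     (\<forall>x\<in>pts X. \<forall>y\<in>pts X. mdst Y (f x) (f y) = mdst X x y)"

text \<open>\<open>pair_dist\<close> is computed from distances among its arguments and the corners,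
  all of which \<open>f\<close> preserves. Thus \<open>M \<otimes> -\<close> preserves isometric
  embeddings.\<close>

lemma pair_dist_emb:
  assumes X: "tri_metric X" and f: "tri_emb X Y f" and x: "x \<in> pts X" "y \<in> pts X"
  shows "pair_dist Y (m, f x) (n, f y) = pair_dist X (m, x) (n, y)"
proof -
  have d: "mdst Y (f u) (f v) = mdst X u v" if "u \<in> pts X" "v \<in> pts X" for u v
    using f that by (simp add: tri_emb_def)
  have P: "ptT Y = f (ptT X)" "ptL Y = f (ptL X)" "ptR Y = f (ptR X)"
    using f by (simp_all add: tri_emb_def)
  show ?thesis
    by (cases m; cases n) (simp_all add: P d x tri_metricD(1-3)[OF X])
qed

lemma chain_0: "chain 0 (Leaf t) = nd 0 (bang_idx t) (Leaf t)"
  by (simp add: inv_into_f_f inj_on_def)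

lemma pts_iter_0: "pts (iter 0) = range Leaf"
  by (simp add: I_space_def)

lemma mdst_iter_0: "mdst (iter 0) (Leaf s) (Leaf t) = (if s = t then 0 else 1)"
  by (simp add: mdst_relabel inj_on_def I_space_def)

text \<open>Conditional on the embedding property because it is used inside the induction that
  proves that property; \<open>tensor_map\<close> can be evaluated only for maps preserving the
  corners.\<close>

lemma chain_nd_aux:
  assumes "tri_emb (iter n) (iter (Suc n)) (chain n)" "u \<in> pts (iter n)"
  shows "chain (Suc n) (nd n m u) = nd (Suc n) m (chain n u)"
proof -
  have "inv_into (pts (tensor (iter n))) node (nd n m u) = tens (iter n) m u"
    by (rule inv_into_f_f) (simp_all add: inj_on_node tri_metric_iter tens_in_pts assms)
  then have "chain (Suc n) (nd n m u) = node (tensor_map (iter (Suc n)) (chain n) (tens (iter n) m u))"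
    by simp
  also have "tensor_map (iter (Suc n)) (chain n) (tens (iter n) m u) = tens (iter (Suc n)) m (chain n u)"
    using assms(1) by (intro tensor_map_tens)
      (auto simp del: iter.simps simp: tri_emb_def assms tri_metricD(1-3)[OF tri_metric_iter])
  finally show ?thesis .
qed

lemma tri_emb_chain: "tri_emb (iter n) (iter (Suc n)) (chain n)"
proof (induction n)
  case 0
  have pt: "ptT (iter 0) = Leaf CT" "ptL (iter 0) = Leaf CL" "ptR (iter 0) = Leaf CR"
    by (simp_all add: I_space_def)
  \<comment> \<open>Distinct corners land in different copies, at distance
    \<open>1/2 * min (1 + 1) (1 + 1 + 1) = 1\<close>.\<close>
  have "mdst (iter 1) (chain 0 (Leaf s)) (chain 0 (Leaf t)) = mdst (iter 0) (Leaf s) (Leaf t)" for s t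
  proof -
    have "mdst (iter 1) (chain 0 (Leaf s)) (chain 0 (Leaf t)) =
        pair_dist (iter 0) (bang_idx s, Leaf s) (bang_idx t, Leaf t)"
      unfolding chain_0 One_nat_def by (rule mdst_nd) (auto simp: pts_iter_0 simp del: iter.simps)
    then show ?thesis
      by (cases s; cases t) (simp_all del: iter.simps add: mdst_iter_0 pt)
  qed
  then show ?case
    unfolding tri_emb_def ptT_iter_Suc ptL_iter_Suc ptR_iter_Suc pt chain_0
    by (auto simp: pts_iter_0 chain_0 simp del: iter.simps chain.simps intro!: nd_in)
next
  case (Suc n)
  note ch = chain_nd_aux[OF Suc]
  have in_: "chain n u \<in> pts (iter (Suc n))" if "u \<in> pts (iter n)" for u
    using Suc that unfolding tri_emb_def by blast
  note D = tri_metricD(1-3)[OF tri_metric_iter]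
  have pt: "chain n (ptT (iter n)) = ptT (iter (Suc n))" "chain n (ptL (iter n)) = ptL (iter (Suc n))"
    "chain n (ptR (iter n)) = ptR (iter (Suc n))"
    using Suc unfolding tri_emb_def by blast+
  show ?case
    unfolding tri_emb_def
  proof (intro conjI ballI)
    show "chain (Suc n) \<in> pts (iter (Suc n)) \<rightarrow> pts (iter (Suc (Suc n)))"
      unfolding pts_iter_Suc[of n] using ch in_ nd_in by (auto simp del: iter.simps chain.simps)
    show "chain (Suc n) (ptT (iter (Suc n))) = ptT (iter (Suc (Suc n)))"
      "chain (Suc n) (ptL (iter (Suc n))) = ptL (iter (Suc (Suc n)))"
      "chain (Suc n) (ptR (iter (Suc n))) = ptR (iter (Suc (Suc n)))"
      using ch[OF D(1), of Ma] ch[OF D(2), of Mb] ch[OF D(3), of Mc]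
      by (simp_all only: pt flip: ptT_iter_Suc ptL_iter_Suc ptR_iter_Suc)
  next
    fix x y assume "x \<in> pts (iter (Suc n))" "y \<in> pts (iter (Suc n))"
    then obtain m u k v where "x = nd n m u" "y = nd n k v" "u \<in> pts (iter n)" "v \<in> pts (iter n)"
      unfolding pts_iter_Suc by blast
    then show "mdst (iter (Suc (Suc n))) (chain (Suc n) x) (chain (Suc n) y) = mdst (iter (Suc n)) x y"
      by (simp only: ch mdst_nd in_ pair_dist_emb[OF tri_metric_iter Suc])
  qed
qed

lemmas chain_nd = chain_nd_aux[OF tri_emb_chain]

lemma chain_in: "u \<in> pts (iter n) \<Longrightarrow> chain n u \<in> pts (iter (Suc n))"
  using tri_emb_chain[of n] unfolding tri_emb_def by blast

lemma mdst_chain: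
  "u \<in> pts (iter n) \<Longrightarrow> v \<in> pts (iter n) \<Longrightarrow>
    mdst (iter (Suc n)) (chain n u) (chain n v) = mdst (iter n) u v"
  using tri_emb_chain[of n] unfolding tri_emb_def by blast

text \<open>The composite chain map from stage \<open>n\<close> to stage \<open>k\<close>. For
  \<open>k < n\<close> the value is \<open>u\<close> by default, without meaning.\<close>

primrec up :: "nat \<Rightarrow> nat \<Rightarrow> itpt \<Rightarrow> itpt" where
  "up n 0 u = u"
| "up n (Suc k) u = (if n \<le> k then chain k (up n k u) else u)"

lemma up_same: "up n n u = u"
  by (cases n) simp_all

lemma up_in:
  assumes "n \<le> k" "u \<in> pts (iter n)"
  shows "up n k u \<in> pts (iter k)"
  using assms(1) by (induction rule: dec_induct)
    (simp_all del: iter.simps chain.simps add: up_same assms chain_in)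

lemma mdst_up:
  assumes "n \<le> k" "u \<in> pts (iter n)" "v \<in> pts (iter n)"
  shows "mdst (iter k) (up n k u) (up n k v) = mdst (iter n) u v"
  using assms(1) by (induction rule: dec_induct)
    (simp_all del: iter.simps chain.simps add: up_same assms mdst_chain up_in)

lemma up_chain:
  assumes "Suc n \<le> k"
  shows "up (Suc n) k (chain n u) = up n k u"
  using assms by (induction rule: dec_induct) (simp_all del: chain.simps add: up_same)

section \<open>The colimit relation and the metric of \<open>G\<close>\<close>

lemma equiv_colim_rel: "equiv iter_sum colim_rel"
proof -
  let ?r = "{((n, u), (Suc n, chain n u)) |n u. u \<in> pts (iter n)}"
  have "sym ((?r \<union> ?r\<inverse>)\<^sup>*)" by (rule sym_rtrancl) (auto simp: sym_def)
  moreover have "trans ((?r \<union> ?r\<inverse>)\<^sup>*)" by (rule trans_rtrancl)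
  ultimately show ?thesis
    unfolding colim_rel_def equiv_gen_def equiv_def refl_on_def sym_def trans_def by blast
qed

lemma colim_rel_up:
  assumes "n \<le> k" "u \<in> pts (iter n)"
  shows "((n, u), (k, up n k u)) \<in> colim_rel"
proof -
  have "((n, u), (k, up n k u)) \<in>
      ({((n, u), (Suc n, chain n u)) |n u. u \<in> pts (iter n)} \<union>
       {((n, u), (Suc n, chain n u)) |n u. u \<in> pts (iter n)}\<inverse>)\<^sup>*"
    using assms(1)
  proof (induction rule: dec_induct)
    case base
    then show ?case by (simp add: up_same)
  next
    case (step k)
    have "up n (Suc k) u = chain k (up n k u)" using step by simp
    then show ?case
      using up_in[OF step(1) assms(2)] by (intro rtrancl_into_rtrancl[OF step(3)]) blast
  qed
  then show ?thesis
    using assms up_in[OF assms] by (simp add: colim_rel_def equiv_gen_def iter_sum_def)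
qed

text \<open>Each generating pair has equal images from the later of its two stages on. Along a
  zigzag of such pairs the finitely many thresholds are absorbed by the eventuality
  quantifier.\<close>

lemma colim_rel_eventually:
  assumes "((n, u), (m, v)) \<in> colim_rel"
  shows "\<forall>\<^sub>F k in sequentially. up n k u = up m k v"
proof -
  have "(p, q) \<in> (r \<union> r\<inverse>)\<^sup>* \<Longrightarrow> \<forall>\<^sub>F k in sequentially. up (fst p) k (snd p) = up (fst q) k (snd q)"
    if r: "r = {((n, u), (Suc n, chain n u)) |n u. u \<in> pts (iter n)}" for p q r
  proof (induction rule: rtrancl_induct)
    case (step q q')
    have "\<forall>\<^sub>F k in sequentially. up n k u = up (Suc n) k (chain n u)" for n u
      by (rule eventually_sequentiallyI[of "Suc n"]) (simp add: up_chain)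
    moreover from this
    have "\<forall>\<^sub>F k in sequentially. up (Suc n) k (chain n u) = up n k u" for n u
      by (simp only: eq_commute)
    ultimately have "\<forall>\<^sub>F k in sequentially. up (fst q) k (snd q) = up (fst q') k (snd q')"
      using step(2) by (auto simp: r simp del: up.simps chain.simps)
    with step(3) show ?case by eventually_elim simp
  qed simp
  from this[OF refl, of "(n, u)" "(m, v)"] show ?thesis
    using assms by (simp add: colim_rel_def equiv_gen_def)
qed

definition colim_class :: "nat \<Rightarrow> itpt \<Rightarrow> (nat \<times> itpt) set" where
  "colim_class n u = colim_rel `` {(n, u)}"

lemma pts_G: "pts G_space = {colim_class n u |n u. u \<in> pts (iter n)}"
  by (auto simp: G_space_def quotient_def colim_class_def iter_sum_def)

lemma colim_class_in: "u \<in> pts (iter n) \<Longrightarrow> colim_class n u \<in> pts G_space"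
  by (auto simp: pts_G)

lemma colim_class_eq:
  assumes "((n, u), (m, v)) \<in> colim_rel"
  shows "colim_class n u = colim_class m v"
  unfolding colim_class_def using equiv_class_eq[OF equiv_colim_rel assms] .

lemma colim_class_up: "n \<le> k \<Longrightarrow> u \<in> pts (iter n) \<Longrightarrow> colim_class k (up n k u) = colim_class n u"
  using colim_class_eq[OF colim_rel_up] by simp

lemma colim_class_self: "u \<in> pts (iter n) \<Longrightarrow> (n, u) \<in> colim_class n u"
  using colim_rel_up[of n n u] by (simp add: up_same colim_class_def)

text \<open>Three points, as in the triangle inequality; the sum of their stages serves as a common
  stage.\<close>

lemma pts_G_common:
  assumes "U \<in> pts G_space" "V \<in> pts G_space" "W \<in> pts G_space"
  obtains k u v w where "u \<in> pts (iter k)" "v \<in> pts (iter k)" "w \<in> pts (iter k)"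
    "U = colim_class k u" "V = colim_class k v" "W = colim_class k w"
proof -
  obtain n u m v l w where "u \<in> pts (iter n)" "v \<in> pts (iter m)" "w \<in> pts (iter l)"
    "U = colim_class n u" "V = colim_class m v" "W = colim_class l w"
    using assms unfolding pts_G by blast
  then show ?thesis
    using that[of "up n (n + m + l) u" "n + m + l" "up m (n + m + l) v" "up l (n + m + l) w"]
    by (simp add: up_in colim_class_up)
qed

text \<open>Any two representatives of a class have the same image at late stages, and the chain
  maps are isometric, so the distance does not depend on the stage.\<close>

lemma mdst_colim_class:
  assumes u: "u \<in> pts (iter p)" "v \<in> pts (iter p)"
  shows "mdst G_space (colim_class p u) (colim_class p v) = mdst (iter p) u v"
proof -
  have "mdst (iter q) u' v' = mdst (iter p) u v" if "(q, u') \<in> colim_class p u" "(q, v') \<in> colim_class p v" for q u' v'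
  proof -
    have r: "((p, u), (q, u')) \<in> colim_rel" "((p, v), (q, v')) \<in> colim_rel"
      using that by (simp_all add: colim_class_def)
    then have in_: "u' \<in> pts (iter q)" "v' \<in> pts (iter q)"
      by (simp_all add: colim_rel_def equiv_gen_def iter_sum_def)
    have "\<forall>\<^sub>F k in sequentially. up p k u = up q k u' \<and> up p k v = up q k v' \<and> p \<le> k \<and> q \<le> k"
      using colim_rel_eventually[OF r(1)] colim_rel_eventually[OF r(2)]
        eventually_ge_at_top[of p] eventually_ge_at_top[of q]
      by eventually_elim simp
    then obtain k where "up p k u = up q k u'" "up p k v = up q k v'" "p \<le> k" "q \<le> k"
      unfolding eventually_sequentially by blast
    then show ?thesis using mdst_up[of p k u v] mdst_up[of q k u' v'] u in_ by simp
  qed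
  then have "{mdst (iter q) u' v' |q u' v'. (q, u') \<in> colim_class p u \<and> (q, v') \<in> colim_class p v} = {mdst (iter p) u v}"
    using colim_class_self u by blast
  then show ?thesis
    using colim_class_in[OF u(1)] colim_class_in[OF u(2)] by (simp add: G_space_def dist_on_def)
qed

text \<open>Each axiom is inherited from a stage that represents all the points involved.\<close>

lemma Metric_space_G: "Metric_space (pts G_space) (mdst G_space)"
proof -
  have I: "Metric_space (pts (iter k)) (mdst (iter k))" for k
    using tri_metric_iter[of k] by (simp add: tri_metric_def)
  have off: "mdst G_space U V = 0" if "\<not> (U \<in> pts G_space \<and> V \<in> pts G_space)" for U V
    using that by (auto simp: G_space_def dist_on_def)
  show ?thesis
  proof
    fix U V
    show "0 \<le> mdst G_space U V"
    proof (cases "U \<in> pts G_space \<and> V \<in> pts G_space")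
      case True
      then show ?thesis
        using pts_G_common[of U V V] mdst_colim_class Metric_space.nonneg[OF I] by metis
    qed (simp add: off)
    show "mdst G_space U V = mdst G_space V U"
    proof (cases "U \<in> pts G_space \<and> V \<in> pts G_space")
      case True
      then show ?thesis
        using pts_G_common[of U V V] mdst_colim_class Metric_space.commute[OF I] by metis
    qed (use off in metis)
  next
    fix U V assume "U \<in> pts G_space" "V \<in> pts G_space"
    then obtain k u v where k: "u \<in> pts (iter k)" "v \<in> pts (iter k)" "U = colim_class k u" "V = colim_class k v"
      using pts_G_common[of U V V] by metis
    have "U = V \<Longrightarrow> mdst G_space U V = 0"
      using mdst_colim_class[OF k(1) k(1)] Metric_space.mdist_zero[OF I k(1)] k by simp
    moreover have "mdst G_space U V = 0 \<Longrightarrow> U = V"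
      using mdst_colim_class[OF k(1,2)] Metric_space.zero[OF I k(1,2)] k by simp
    ultimately show "mdst G_space U V = 0 \<longleftrightarrow> U = V" by blast
  next
    fix U V W assume "U \<in> pts G_space" "V \<in> pts G_space" "W \<in> pts G_space"
    then obtain k u v w where "u \<in> pts (iter k)" "v \<in> pts (iter k)" "w \<in> pts (iter k)"
      "U = colim_class k u" "V = colim_class k v" "W = colim_class k w"
      using pts_G_common by metis
    then show "mdst G_space U W \<le> mdst G_space U V + mdst G_space V W"
      using Metric_space.triangle[OF I] by (simp add: mdst_colim_class)
  qed
qed

lemma pt_G: "ptT G_space = colim_class n (ptT (iter n))" "ptL G_space = colim_class n (ptL (iter n))"
  "ptR G_space = colim_class n (ptR (iter n))"
proof -
  note D = tri_metricD(1-3)[OF tri_metric_iter]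
  have "chain n (ptT (iter n)) = ptT (iter (Suc n))" "chain n (ptL (iter n)) = ptL (iter (Suc n))"
    "chain n (ptR (iter n)) = ptR (iter (Suc n))" for n
    using tri_emb_chain[of n] unfolding tri_emb_def by blast+
  then have "colim_class (Suc n) (ptT (iter (Suc n))) = colim_class n (ptT (iter n))"
      "colim_class (Suc n) (ptL (iter (Suc n))) = colim_class n (ptL (iter n))"
      "colim_class (Suc n) (ptR (iter (Suc n))) = colim_class n (ptR (iter n))" for n
    using colim_class_up[of n "Suc n" "ptT (iter n)"] colim_class_up[of n "Suc n" "ptL (iter n)"]
      colim_class_up[of n "Suc n" "ptR (iter n)"] D
    by (simp_all del: iter.simps chain.simps add: up_same)
  note S = this
  show "ptT G_space = colim_class n (ptT (iter n))"
    by (induction n) (simp_all only: S, simp add: G_space_def colim_class_def I_space_def)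
  show "ptL G_space = colim_class n (ptL (iter n))"
    by (induction n) (simp_all only: S, simp add: G_space_def colim_class_def I_space_def)
  show "ptR G_space = colim_class n (ptR (iter n))"
    by (induction n) (simp_all only: S, simp add: G_space_def colim_class_def I_space_def)
qed

lemma pt_G_in: "ptT G_space \<in> pts G_space" "ptL G_space \<in> pts G_space" "ptR G_space \<in> pts G_space"
  using pt_G[of 0] colim_class_in tri_metricD(1-3)[OF tri_metric_iter] by metis+

section \<open>The structure map \<open>g\<close>\<close>

lemma nd_colim_rel:
  assumes "((n, u), (k, v)) \<in> colim_rel"
  shows "colim_class (Suc n) (nd n m u) = colim_class (Suc k) (nd k m v)"
proof -
  \<comment> \<open>\<open>m \<otimes> -\<close> commutes with the chain maps, so one generating
    pair leaves the class unchanged.\<close>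
  have raise: "colim_class (Suc (Suc n)) (nd (Suc n) m (chain n u)) = colim_class (Suc n) (nd n m u)"
    if "u \<in> pts (iter n)" for n u
    using colim_class_up[of "Suc n" "Suc (Suc n)" "nd n m u"] chain_nd[OF that, of m] nd_in[OF that, of m]
    by (simp del: iter.simps chain.simps add: up_same)
  have "(p, q) \<in> (r \<union> r\<inverse>)\<^sup>* \<Longrightarrow>
      colim_class (Suc (fst p)) (nd (fst p) m (snd p)) = colim_class (Suc (fst q)) (nd (fst q) m (snd q))"
    if r: "r = {((n, u), (Suc n, chain n u)) |n u. u \<in> pts (iter n)}" for p q r
  proof (induction rule: rtrancl_induct)
    case (step q q')
    then obtain n u where "u \<in> pts (iter n)"
      "q = (n, u) \<and> q' = (Suc n, chain n u) \<or> q' = (n, u) \<and> q = (Suc n, chain n u)"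
      unfolding r by blast
    then show ?case using step(3) raise by (auto simp del: iter.simps chain.simps)
  qed simp
  from this[OF refl, of "(n, u)" "(k, v)"] show ?thesis
    using assms by (simp add: colim_rel_def equiv_gen_def)
qed

lemma UN_colim_class:
  assumes "u \<in> pts (iter n)"
  shows "(\<Union>(k, v)\<in>colim_class n u. colim_class (Suc k) (nd k m v)) = colim_class (Suc n) (nd n m u)"
proof -
  have "colim_class (Suc k) (nd k m v) = colim_class (Suc n) (nd n m u)" if "(k, v) \<in> colim_class n u" for k v
    using nd_colim_rel[of n u k v m] that by (simp add: colim_class_def)
  then show ?thesis using colim_class_self[OF assms] by blast
qed

abbreviation g_at :: "idx \<Rightarrow> (nat \<times> itpt) set \<Rightarrow> (nat \<times> itpt) set" where
  "g_at m U \<equiv> g_map (tens G_space m U)"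

lemma g_at_colim_class:
  assumes "u \<in> pts (iter n)"
  shows "g_at m (colim_class n u) = colim_class (Suc n) (nd n m u)"
proof -
  define h where "h = (\<lambda>(m, U). \<Union>(k, v)\<in>U. colim_class (Suc k) (nd k m v))"
  have h: "h (m, colim_class n u) = colim_class (Suc n) (nd n m u)" if "u \<in> pts (iter n)" for m n u
    unfolding h_def using UN_colim_class[OF that] by simp
  have "g_map W = (\<Union>p\<in>W. h p)" for W
    by (auto simp: g_map_def h_def colim_class_def split_beta)
  moreover have "(\<Union>p\<in>tens G_space m (colim_class n u). h p) = h (m, colim_class n u)"
  proof (rule UN_tens)
    \<comment> \<open>The corners of \<open>G\<close> are represented at stage 0, where
      \<open>tens_glue\<close> already identifies the two terms.\<close>
    show "h p = h q" if "(p, q) \<in> glue G_space" for p q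
      using that tens_glue[of "iter 0"] tri_metricD(1-3)[OF tri_metric_iter[of 0]]
      by (auto simp: glue_def pt_G[of 0] h simp del: iter.simps)
  qed (use assms in \<open>rule colim_class_in\<close>)
  ultimately show ?thesis using h[OF assms] by simp
qed

lemma g_at_in: "U \<in> pts G_space \<Longrightarrow> g_at m U \<in> pts G_space"
  using g_at_colim_class nd_in colim_class_in by (auto simp: pts_G simp del: iter.simps)

lemma mdst_g_at:
  assumes "U \<in> pts G_space" "V \<in> pts G_space"
  shows "mdst G_space (g_at m U) (g_at m V) = mdst G_space U V / 2"
proof -
  obtain k u v where k: "u \<in> pts (iter k)" "v \<in> pts (iter k)" "U = colim_class k u" "V = colim_class k v"
    using pts_G_common[OF assms assms(2)] by metis
  have "pair_dist (iter k) (m, u) (m, v) = mdst (iter k) u v / 2" by (cases m) auto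
  then show ?thesis
    using mdst_nd[OF k(1,2), of m m] by (simp add: k g_at_colim_class mdst_colim_class nd_in del: iter.simps)
qed

lemma g_at_surj:
  assumes "U \<in> pts G_space"
  obtains m V where "V \<in> pts G_space" "U = g_at m V"
proof -
  obtain n u where u: "u \<in> pts (iter n)" "U = colim_class n u" using assms by (auto simp: pts_G)
  \<comment> \<open>A representative at stage 0 is a leaf and not a tensor; one step up the chain
    every element has the form \<open>nd n m v\<close>.\<close>
  then have "U = colim_class (Suc n) (chain n u)"
    using colim_class_up[of n "Suc n" u] by (simp add: up_same del: chain.simps iter.simps)
  moreover obtain m v where "v \<in> pts (iter n)" "chain n u = nd n m v"
    using chain_in[OF u(1)] unfolding pts_iter_Suc by blast
  ultimately show ?thesis using that[of "colim_class n v" m] u(2) by (simp add: colim_class_in g_at_colim_class del: iter.simps)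
qed

section \<open>The completion\<close>

text \<open>The quadrilateral inequality. It yields both the convergence of distances along Cauchy
  sequences and their independence of the representatives.\<close>

lemma Metric_space_abs_diff:
  assumes "Metric_space M d" "x \<in> M" "y \<in> M" "x' \<in> M" "y' \<in> M"
  shows "\<bar>d x y - d x' y'\<bar> \<le> d x x' + d y y'"
proof -
  interpret Metric_space M d by fact
  have "d x y \<le> d x x' + (d x' y' + d y' y)" "d x' y' \<le> d x' x + (d x y + d y y')"
    using triangle[of x x' y] triangle[of x' y' y] triangle[of x' x y'] triangle[of x y y'] assms(2-5)
    by auto
  then show ?thesis by (simp add: commute abs_if)
qed

section \<open>Cauchy sequences, their classes and the limit metric\<close>

lemma cauchy_seqsD:
  "Metric_space (pts X) (mdst X) \<Longrightarrow> x \<in> cauchy_seqs X \<Longrightarrow> x n \<in> pts X"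
  by (auto simp: cauchy_seqs_def Metric_space.MCauchy_def)

lemma cauchy_seqs_mdst:
  assumes "Metric_space (pts X) (mdst X)" "x \<in> cauchy_seqs X" "0 < e"
  obtains N where "\<And>n n'. N \<le> n \<Longrightarrow> N \<le> n' \<Longrightarrow> mdst X (x n) (x n') < e"
  using assms by (force simp: cauchy_seqs_def Metric_space.MCauchy_def)

lemma convergent_mdst:
  assumes X: "Metric_space (pts X) (mdst X)" and x: "x \<in> cauchy_seqs X" "y \<in> cauchy_seqs X"
  shows "convergent (\<lambda>n. mdst X (x n) (y n))"
proof -
  interpret Metric_space "pts X" "mdst X" by fact
  have "Cauchy (\<lambda>n. mdst X (x n) (y n))"
  proof (rule CauchyI)
    fix e :: real assume "0 < e"
    then have "0 < e / 2" by simp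
    then obtain N1 N2 where N1: "\<And>n n'. N1 \<le> n \<Longrightarrow> N1 \<le> n' \<Longrightarrow> mdst X (x n) (x n') < e / 2"
      and N2: "\<And>n n'. N2 \<le> n \<Longrightarrow> N2 \<le> n' \<Longrightarrow> mdst X (y n) (y n') < e / 2"
      by (meson cauchy_seqs_mdst[OF X] x)
    have "x n \<in> pts X" "y n \<in> pts X" for n
      by (rule cauchy_seqsD[OF X]; fact x)+
    then have "norm (mdst X (x m) (y m) - mdst X (x n) (y n)) < e" if "max N1 N2 \<le> m" "max N1 N2 \<le> n" for m n
      using Metric_space_abs_diff[OF X, of "x m" "y m" "x n" "y n"] N1[of m n] N2[of m n] that by simp
    then show "\<exists>M. \<forall>m\<ge>M. \<forall>n\<ge>M. norm (mdst X (x m) (y m) - mdst X (x n) (y n)) < e" by blast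
  qed
  then show ?thesis by (rule Cauchy_convergent)
qed

lemma equiv_cauchy_rel:
  assumes X: "Metric_space (pts X) (mdst X)"
  shows "equiv (cauchy_seqs X) (cauchy_rel X)"
proof -
  interpret Metric_space "pts X" "mdst X" by fact
  note in_ = cauchy_seqsD[OF X]
  have "(x, z) \<in> cauchy_rel X" if "(x, y) \<in> cauchy_rel X" "(y, z) \<in> cauchy_rel X" for x y z
  proof -
    have "(\<lambda>n. mdst X (x n) (y n) + mdst X (y n) (z n)) \<longlonglongrightarrow> 0 + 0"
      using that by (intro tendsto_add) (simp_all add: cauchy_rel_def)
    then have lim: "(\<lambda>n. mdst X (x n) (y n) + mdst X (y n) (z n)) \<longlonglongrightarrow> 0" by simp
    have "x n \<in> pts X" "y n \<in> pts X" "z n \<in> pts X" for n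
      using that in_ by (auto simp: cauchy_rel_def)
    then have "norm (mdst X (x n) (z n)) \<le> mdst X (x n) (y n) + mdst X (y n) (z n)" for n
      using triangle by simp
    then have "(\<lambda>n. mdst X (x n) (z n)) \<longlonglongrightarrow> 0"
      by (intro Lim_null_comparison[OF _ lim] always_eventually) simp
    then show ?thesis using that by (simp add: cauchy_rel_def)
  qed
  then show ?thesis
    by (intro equivI refl_onI symI transI)
      (auto simp: cauchy_rel_def commute in_)
qed

definition cauchy_class :: "'a tri_space \<Rightarrow> (nat \<Rightarrow> 'a) \<Rightarrow> (nat \<Rightarrow> 'a) set" where
  "cauchy_class X x = cauchy_rel X `` {x}"

lemma cauchy_class_eqI:
  assumes "Metric_space (pts X) (mdst X)" "x \<in> cauchy_seqs X" "y \<in> cauchy_seqs X"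
    "(\<lambda>n. mdst X (x n) (y n)) \<longlonglongrightarrow> 0"
  shows "cauchy_class X x = cauchy_class X y"
  unfolding cauchy_class_def
  by (rule equiv_class_eq[OF equiv_cauchy_rel]) (use assms in \<open>simp_all add: cauchy_rel_def\<close>)

lemma cauchy_class_self: "Metric_space (pts X) (mdst X) \<Longrightarrow> x \<in> cauchy_seqs X \<Longrightarrow> x \<in> cauchy_class X x"
  unfolding cauchy_class_def by (rule equiv_class_self[OF equiv_cauchy_rel])

lemma pts_completion: "pts (completion X) = cauchy_class X ` cauchy_seqs X"
  by (auto simp: completion_def quotient_def cauchy_class_def)

text \<open>Formulated as convergence, so that distances in the completion can be identified by
  uniqueness of limits.\<close>

lemma mdst_completion:
  assumes X: "Metric_space (pts X) (mdst X)" and x: "x \<in> cauchy_seqs X" "y \<in> cauchy_seqs X"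
  shows "(\<lambda>n. mdst X (x n) (y n)) \<longlonglongrightarrow> mdst (completion X) (cauchy_class X x) (cauchy_class X y)"
proof -
  interpret Metric_space "pts X" "mdst X" by fact
  note in_ = cauchy_seqsD[OF X]
  have L: "(\<lambda>n. mdst X (x n) (y n)) \<longlonglongrightarrow> lim (\<lambda>n. mdst X (x n) (y n))"
    using convergent_mdst[OF X x] by (simp add: convergent_LIMSEQ_iff)
  have eq: "lim (\<lambda>n. mdst X (x' n) (y' n)) = lim (\<lambda>n. mdst X (x n) (y n))"
    if "x' \<in> cauchy_class X x" "y' \<in> cauchy_class X y" for x' y'
  proof -
    have xy': "x' \<in> cauchy_seqs X" "y' \<in> cauchy_seqs X"
      and z: "(\<lambda>n. mdst X (x n) (x' n) + mdst X (y n) (y' n)) \<longlonglongrightarrow> 0"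
      using that by (auto simp: cauchy_class_def cauchy_rel_def intro: tendsto_add_zero)
    have "(\<lambda>n. mdst X (x' n) (y' n) - mdst X (x n) (y n)) \<longlonglongrightarrow> 0"
    proof (rule Lim_null_comparison[OF _ z])
      show "\<forall>\<^sub>F n in sequentially. norm (mdst X (x' n) (y' n) - mdst X (x n) (y n)) \<le>
          mdst X (x n) (x' n) + mdst X (y n) (y' n)"
      proof (rule always_eventually, rule allI)
        fix n show "norm (mdst X (x' n) (y' n) - mdst X (x n) (y n)) \<le>
          mdst X (x n) (x' n) + mdst X (y n) (y' n)"
          using Metric_space_abs_diff[OF X in_[OF xy'(1), of n] in_[OF xy'(2), of n] in_[OF x(1), of n] in_[OF x(2), of n]]
          by (simp add: commute)
      qed
    qed
    from tendsto_add[OF this L] show ?thesis by (simp add: limI)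
  qed
  have "{lim (\<lambda>n. mdst X (x' n) (y' n)) |x' y'. x' \<in> cauchy_class X x \<and> y' \<in> cauchy_class X y} = {lim (\<lambda>n. mdst X (x n) (y n))}"
    using eq cauchy_class_self[OF X x(1)] cauchy_class_self[OF X x(2)] by blast
  moreover have "cauchy_class X x \<in> cauchy_seqs X // cauchy_rel X" "cauchy_class X y \<in> cauchy_seqs X // cauchy_rel X"
    using x by (simp_all add: cauchy_class_def quotientI)
  ultimately have "mdst (completion X) (cauchy_class X x) (cauchy_class X y) = lim (\<lambda>n. mdst X (x n) (y n))"
    by (simp add: completion_def dist_on_def)
  then show ?thesis using L by simp
qed

lemma const_cauchy:
  "Metric_space (pts X) (mdst X) \<Longrightarrow> x \<in> pts X \<Longrightarrow> (\<lambda>_. x) \<in> cauchy_seqs X"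
  by (simp add: cauchy_seqs_def Metric_space.MCauchy_def Metric_space.mdist_zero)

lemma mdst_completion_const:
  assumes "Metric_space (pts X) (mdst X)" "x \<in> pts X" "y \<in> pts X"
  shows "mdst (completion X) (cauchy_class X (\<lambda>_. x)) (cauchy_class X (\<lambda>_. y)) = mdst X x y"
  using mdst_completion[OF assms(1) const_cauchy const_cauchy] assms
  by (metis LIMSEQ_const_iff)

section \<open>The structure map \<open>s\<close> and its surjectivity\<close>

lemma g_at_cauchy_iff:
  assumes "range x \<subseteq> pts G_space"
  shows "(\<lambda>n. g_at m (x n)) \<in> cauchy_seqs G_space \<longleftrightarrow> x \<in> cauchy_seqs G_space"
proof -
  interpret Metric_space "pts G_space" "mdst G_space" by (rule Metric_space_G)
  have in_: "x n \<in> pts G_space" for n using assms by blast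
  have *: "mdst G_space (g_at m (x n)) (g_at m (x k)) = mdst G_space (x n) (x k) / 2" for n k
    by (rule mdst_g_at) (rule in_)+
  \<comment> \<open>Distances are halved exactly, so the Cauchy condition passes both ways;
    surjectivity of \<open>s_map\<close> uses the way back from the images to
    \<open>x\<close>.\<close>
  have "(\<forall>e>0. \<exists>N. \<forall>n k. N \<le> n \<longrightarrow> N \<le> k \<longrightarrow> mdst G_space (x n) (x k) / 2 < e) \<longleftrightarrow>
      (\<forall>e>0. \<exists>N. \<forall>n k. N \<le> n \<longrightarrow> N \<le> k \<longrightarrow> mdst G_space (x n) (x k) < e)" (is "?l \<longleftrightarrow> ?r")
  proof
    assume ?l
    show ?r
    proof (intro allI impI)
      fix e :: real assume "e > 0"
      with \<open>?l\<close> obtain N where "\<forall>n k. N \<le> n \<longrightarrow> N \<le> k \<longrightarrow> mdst G_space (x n) (x k) / 2 < e / 2"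
        using half_gt_zero by blast
      then show "\<exists>N. \<forall>n k. N \<le> n \<longrightarrow> N \<le> k \<longrightarrow> mdst G_space (x n) (x k) < e" by auto
    qed
  next
    assume ?r
    have "mdst G_space (x n) (x k) < e \<Longrightarrow> mdst G_space (x n) (x k) / 2 < e" for n k e
      using nonneg[of "x n" "x k"] by linarith
    with \<open>?r\<close> show ?l by meson
  qed
  then show ?thesis
    using in_ g_at_in by (auto simp: cauchy_seqs_def MCauchy_def * image_subset_iff)
qed

lemma g_at_cauchy: "x \<in> cauchy_seqs G_space \<Longrightarrow> (\<lambda>n. g_at m (x n)) \<in> cauchy_seqs G_space"
  using g_at_cauchy_iff cauchy_seqsD[OF Metric_space_G] by blast

lemma pts_S: "pts S_space = cauchy_class G_space ` cauchy_seqs G_space"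
  by (simp add: S_space_def pts_completion)

lemma pt_S: "ptT S_space = cauchy_class G_space (\<lambda>_. ptT G_space)" "ptL S_space = cauchy_class G_space (\<lambda>_. ptL G_space)"
  "ptR S_space = cauchy_class G_space (\<lambda>_. ptR G_space)"
  by (simp_all add: S_space_def completion_def cauchy_class_def)

lemma s_map_tens:
  assumes x: "x \<in> cauchy_seqs G_space"
  shows "s_map (tens S_space m (cauchy_class G_space x)) = cauchy_class G_space (\<lambda>n. g_at m (x n))"
proof -
  define h where "h = (\<lambda>(m, \<xi>). \<Union>x\<in>\<xi>. cauchy_class G_space (\<lambda>n. g_at m (x n)))"
  have h: "h (m, cauchy_class G_space x) = cauchy_class G_space (\<lambda>n. g_at m (x n))" if "x \<in> cauchy_seqs G_space" for m x
  proof -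
    have "cauchy_class G_space (\<lambda>n. g_at m (y n)) = cauchy_class G_space (\<lambda>n. g_at m (x n))" if y: "y \<in> cauchy_class G_space x" for y
    proof -
      have yx: "y \<in> cauchy_seqs G_space" "x \<in> cauchy_seqs G_space"
        "(\<lambda>n. mdst G_space (x n) (y n)) \<longlonglongrightarrow> 0"
        using y by (simp_all add: cauchy_class_def cauchy_rel_def)
      have "(\<lambda>n. mdst G_space (g_at m (x n)) (g_at m (y n))) \<longlonglongrightarrow> 0"
        using yx(3) yx(1,2)[THEN cauchy_seqsD[OF Metric_space_G]]
        by (simp add: mdst_g_at tendsto_divide_zero)
      then show ?thesis
        using cauchy_class_eqI[OF Metric_space_G g_at_cauchy[OF yx(2)] g_at_cauchy[OF yx(1)]] by simp
    qed
    then have "h (m, cauchy_class G_space x) = (\<Union>y\<in>cauchy_class G_space x. cauchy_class G_space (\<lambda>n. g_at m (x n)))"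
      unfolding h_def prod.case by (rule SUP_cong[OF refl])
    moreover have "cauchy_class G_space x \<noteq> {}" using cauchy_class_self[OF Metric_space_G that] by blast
    ultimately show ?thesis by simp
  qed
  note const = const_cauchy[OF Metric_space_G]
  have "s_map W = (\<Union>p\<in>W. h p)" for W
    by (auto simp: s_map_def h_def cauchy_class_def split_beta)
  moreover have "(\<Union>p\<in>tens S_space m (cauchy_class G_space x). h p) = h (m, cauchy_class G_space x)"
  proof (rule UN_tens)
    \<comment> \<open>The corners of \<open>S\<close> are classes of constant sequences, so the glue
      pairs agree because they do in \<open>G\<close>.\<close>
    show "h p = h q" if "(p, q) \<in> glue S_space" for p q
      using that tens_glue[OF pt_G_in] pt_G_in
      by (auto simp: glue_def pt_S h const)
  qed (use x in \<open>simp add: pts_S\<close>)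
  ultimately show ?thesis using h[OF x] by simp
qed

text \<open>Infinitely many terms of a Cauchy sequence lie in one copy of \<open>G\<close>. Along
  that subsequence the preimages are again Cauchy, and the subsequence has the same class as the
  whole sequence.\<close>

lemma s_map_surj:
  assumes x: "x \<in> cauchy_seqs G_space"
  shows "cauchy_class G_space x \<in> s_map ` pts (tensor S_space)"
proof -
  interpret Metric_space "pts G_space" "mdst G_space" by (rule Metric_space_G)
  have "\<exists>m V. V \<in> pts G_space \<and> x n = g_at m V" for n
    by (rule g_at_surj[OF cauchy_seqsD[OF Metric_space_G x, of n]]) blast
  then obtain m V where V: "\<And>n. V n \<in> pts G_space" "\<And>n. x n = g_at (m n) (V n)" by metis
  obtain i where "infinite {n. m n = i}"
    using idx_infinite_fibre by blast
  then obtain r :: "nat \<Rightarrow> nat" where r: "strict_mono r" "\<And>n. m (r n) = i"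
    using infinite_enumerate by blast
  have xr: "x (r n) = g_at i (V (r n))" for n using V r by metis
  have "x \<circ> r \<in> cauchy_seqs G_space"
    using MCauchy_subsequence[OF r(1)] x by (simp add: cauchy_seqs_def)
  then have xr_C: "(\<lambda>n. g_at i (V (r n))) \<in> cauchy_seqs G_space" by (simp add: o_def xr)
  then have Vr: "(\<lambda>n. V (r n)) \<in> cauchy_seqs G_space"
    using g_at_cauchy_iff[of "\<lambda>n. V (r n)"] V by blast
  have "(\<lambda>n. mdst G_space (x n) (x (r n))) \<longlonglongrightarrow> 0"
  proof (rule LIMSEQ_I)
    fix e :: real assume "e > 0"
    then obtain N where "\<And>n n'. N \<le> n \<Longrightarrow> N \<le> n' \<Longrightarrow> mdst G_space (x n) (x n') < e"
      by (meson cauchy_seqs_mdst[OF Metric_space_G x])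
    moreover have "N \<le> r n" if "N \<le> n" for n
      using seq_suble[OF r(1), of n] that by simp
    ultimately show "\<exists>N. \<forall>n\<ge>N. norm (mdst G_space (x n) (x (r n)) - 0) < e" by auto
  qed
  then have "cauchy_class G_space x = s_map (tens S_space i (cauchy_class G_space (\<lambda>n. V (r n))))"
    using cauchy_class_eqI[OF Metric_space_G x xr_C] by (simp add: xr s_map_tens[OF Vr])
  moreover have "tens S_space i (cauchy_class G_space (\<lambda>n. V (r n))) \<in> pts (tensor S_space)"
    using Vr by (intro tens_in_pts) (simp add: pts_S)
  ultimately show ?thesis by blast
qed

lemma s_map_S_coalg: "y \<in> pts S_space \<Longrightarrow> s_map (S_coalg y) = y"
  using s_map_surj by (auto simp: S_coalg_def pts_S f_inv_into_f)

lemma S_not_final: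
  assumes "infinite (UNIV :: 'u set)"
  shows "\<not> final_coalgebra TYPE('u) S_space S_coalg"
proof (rule not_final_if_expanding[OF assms])
  have pt: "ptT (iter 0) = Leaf CT" "ptL (iter 0) = Leaf CL"
    by (simp_all add: I_space_def)
  \<comment> \<open>The distance 1 of \<open>T\<close> and \<open>L\<close> at stage 0 passes to the
    colimit and then to constant sequences.\<close>
  have "mdst G_space (ptT G_space) (ptL G_space) = mdst (iter 0) (ptT (iter 0)) (ptL (iter 0))"
    unfolding pt_G[of 0] by (rule mdst_colim_class) (rule tri_metricD(1,2)[OF tri_metric_iter])+
  then show "mdst S_space (ptT S_space) (ptL S_space) = 1"
    unfolding pt_S unfolding S_space_def
    by (simp add: mdst_completion_const[OF Metric_space_G] pt_G_in tri_metricD(7)[OF tri_metric_iter]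
        del: iter.simps)
next
  fix x x' y y'
  assume x: "x \<in> pts S_space" "x' \<in> pts S_space" and y: "y \<in> pts S_space" "y' \<in> pts S_space"
    and e: "S_coalg y = tens S_space Mb x" "S_coalg y' = tens S_space Mb x'"
  obtain a b where ab: "a \<in> cauchy_seqs G_space" "b \<in> cauchy_seqs G_space"
    "x = cauchy_class G_space a" "x' = cauchy_class G_space b" using x by (auto simp: pts_S)
  \<comment> \<open>Applying \<open>s_map\<close> to both hypotheses exhibits \<open>y\<close> and
    \<open>y'\<close> as images under copy \<open>b\<close>; distances are then halved term by term,
    and in the limit.\<close>
  have "y = cauchy_class G_space (\<lambda>n. g_at Mb (a n))" "y' = cauchy_class G_space (\<lambda>n. g_at Mb (b n))"
    using s_map_S_coalg[OF y(1)] s_map_S_coalg[OF y(2)] by (simp_all add: e ab s_map_tens)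
  then have "(\<lambda>n. mdst G_space (g_at Mb (a n)) (g_at Mb (b n))) \<longlonglongrightarrow> mdst S_space y y'"
    using mdst_completion[OF Metric_space_G g_at_cauchy[OF ab(1)] g_at_cauchy[OF ab(2)]]
    by (simp add: S_space_def)
  then have "(\<lambda>n. mdst G_space (a n) (b n) / 2) \<longlonglongrightarrow> mdst S_space y y'"
    using ab(1,2)[THEN cauchy_seqsD[OF Metric_space_G]] by (simp add: mdst_g_at)
  moreover have "(\<lambda>n. mdst G_space (a n) (b n) / 2) \<longlonglongrightarrow> mdst S_space x x' / 2"
    unfolding ab S_space_def by (intro tendsto_divide mdst_completion[OF Metric_space_G] ab) auto
  ultimately have "mdst S_space y y' = mdst S_space x x' / 2"
    by (rule LIMSEQ_unique)
  then show "mdst S_space x x' \<le> 2 * mdst S_space y y'" by simp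
qed

theorem mainTheorem6:
  assumes "infinite (UNIV :: 'u set)"
  shows "\<not> final_coalgebra TYPE('u) S_space S_coalg \<and> \<not> final_coalgebra TYPE('u) gasket_space gasket_coalg"
  using S_not_final[OF assms] gasket_not_final[OF assms] by blast

end
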